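(* For every integer $r\geq 1$, the local entropy of $f_r$ is $$h_{loc}(f_r)=\frac{\log R(f_r)}{r}=\log\lambda,$$ where $R(f_r)=\inf_{k\geq1}\sqrt[k]{\|(f_r^k)'\|_\infty}$.
   Context: Local entropy. Let $T\colon X\to X$ be a continuous map on a compact metric space $(X,d)$. The Bowen ball of radius $\rho$ and order $n$ centered at $x$ is $B_n(x,\rho)=\{y\in X: d(T^k(y),T^k(x))<\rho,\ k=0,\dots,n-1\}$. For $Y\subset X$, a subset $E\subset Y$ is $(\varepsilon,n)$-separated if for all $y\neq y'$ in $E$ there is $0\leq k<n$ with $d(T^k(y),T^k(y'))>\varepsilon$; $s_n(T,\varepsilon,Y)$ is the maximal cardinality of an $(\varepsilon,n)$-separated set of $Y$. The local entropy is $h_{loc}(T)=\lim_{\varepsilon\to0}\lim_{\eta\to0}\limsup_{n\to\infty}\frac1n\sup_{x\in X}\log s_n(T,\eta,B_n(x,\varepsilon))$. Here $f_r^k$ is the $k$-th iterate of $f_r$ and $\|\cdot\|_\infty$ the sup norm. Construction of $f_r$. Fix a real number $\lambda\geq 14$ and an integer $r\geq 1$. Put $I=[0,4]$, $\delta=\lambda^{-r}$, $C=\frac{1}{4\delta^2}$, and for $n\geq 1$: $x_n=1+\frac1n$, $y_n=x_n+\frac{1}{2n^2}$ (so $y_1=\frac52$), $M_n=2\left\lfloor\frac{\lambda^n}{2n^2}\right\rfloor-1$ (an odd integer), $m_n=1-\frac{1}{(n+1)^2}$, $k_n=\frac{2\lambda^r}{M_n}$. The map $f_r\colon I\to I$ is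 obtained as follows (functions not given explicitly are arbitrary subject to the listed conditions); it is $C^\infty$ on $[0,4]\setminus\{1\}$ and $C^r$ on $[0,4]$. (a) On $[x_n,y_n]$, $n\geq 1$: $f_r(x)=\lambda^{-nr}\left[x_n+(y_n-x_n)\,s_n\!\left(M_n\frac{x-x_n}{y_n-x_n}\right)\right]$, where the $s_n\colon[0,M_n]\to[-m_n,1]$ are $C^\infty$ functions such that: $s_n(0)=0$, $s_n(M_n)=1$, $s_n$ is increasing on each $[2k,2k+1]$ ($0\leq k\leq (M_n-1)/2$) and decreasing on each $[2k+1,2k+2]$ ($0\leq k\leq (M_n-3)/2$); $s_n(x)=1-C(x-a)^2$ for $|x-a|\leq\delta$ if $a\neq M_n$ is a local maximum of $s_n$, and $s_n(x)=-m_n+C(x-b)^2$ for $|x-b|\leq\delta$ if $b\neq0$ is a local minimum of $s_n$; $s_n(x)=k_n(x-M_n)+1$ for $M_n-\delta\leq x\leq M_n$; $s_n(x)=k_nx$ for $0\leq x\leq\delta$; for every $k\geq 1$ there is a constant $A_k$ independent of $n$ with $\|s_n^{(k)}\|_\infty\leq A_k$ for all $n$; $\|s_n'\|_\infty\leq\lambda^r$, and $|s_n'(x)|\geq\min\{1/2,k_n\}$ whenever $|x-d|\geq\delta$ for all local extrema $d\in(0,M_n)$. (b) On $[y_{n+1},x_n]$, $n\geq1$: let $w_n=y_{n+1}+\frac{n+2}{2n(n+1)^2M_{n+1}k_{n+1}}\in(y_{n+1},x_n)$. On $[y_{n+1},w_n]$, $f_r$ is affine of slope $\lambda^{-(n+1)r}M_{n+1}k_{n+1}$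 with $f_r(y_{n+1})=\lambda^{-(n+1)r}y_{n+1}$. Put $l_n=x_n-w_n$, $h_n=f_r(x_n)-f_r(w_n)$. On $[w_n,x_n]$, $f_r(w_n+l_nt)=f_r(w_n)+h_n\varphi_n(t)$ for $t\in[0,1]$, where the $\varphi_n\colon[0,1]\to[0,1]$ are $C^\infty$ with $\varphi_n(0)=0$, $\varphi_n(1)=1$, $\varphi_n'(0)=2h_n^{-1}l_n\lambda^{-nr}$, $\varphi_n'(1)=2h_n^{-1}l_n\lambda^{-(n-1)r}$, $\varphi_n^{(k)}(0)=\varphi_n^{(k)}(1)=0$ for $k\geq2$, $\frac23\varphi_n'(0)\leq\varphi_n'\leq\lambda^r$ on $[0,1]$, and for every $k\geq1$ there is $B_k$ independent of $n$ with $\|\varphi_n^{(k)}\|_\infty\leq B_k$ for all $n$. (c) On $[0,1]\cup[y_1,4]$: $f_r(x)=\lambda^rx$ for $0\leq x\leq\frac52\delta$; $f_r(x)=4-\frac32\delta^{-1}(x-\frac12)^2$ for $|x-\frac12|\leq\delta$; $f_r(x)=\delta^{1-2r}(x-1)^{2r}$ for $1-\delta\leq x\leq1$; $f_r(x)=4+\lambda^r(x-4)$ for $4-\frac32\delta\leq x\leq4$; and $f_r$ is completed so that the pieces glue together in a $C^\infty$ way (except at $1$), with $\frac32\leq f_r'\leq\lambda^r$ on $[\frac52\delta,\frac12-\delta]$, $-\lambda^r\leq f_r'\leq-\frac32$ on $[\frac12+\delta,1-\delta]$, and $\frac32\leq f_r'\leq\lambda^r$ on $[y_1,4]$. *)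

theory Defs
  imports "HOL-Analysis.Analysis"
begin

section \<open>Derivatives, smoothness and sup norms on subsets of the real line\<close>

text \<open>
  Derivatives are taken within the domain, hence are one-sided at the end points of an interval.
  On the sets used below (nondegenerate intervals, and an interval minus one point) derivatives
  within the set are unique.
\<close>

definition deriv_on :: "real set \<Rightarrow> (real \<Rightarrow> real) \<Rightarrow> real \<Rightarrow> real" where
  "deriv_on S g x = vector_derivative g (at x within S)"

definition nth_deriv_on :: "real set \<Rightarrow> nat \<Rightarrow> (real \<Rightarrow> real) \<Rightarrow> real \<Rightarrow> real" where
  "nth_deriv_on S k g = (deriv_on S ^^ k) g"

definition Ck_on :: "nat \<Rightarrow> real set \<Rightarrow> (real \<Rightarrow> real) \<Rightarrow> bool" where
  "Ck_on k S g \<longleftrightarrow>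
     (\<forall>j<k. nth_deriv_on S j g differentiable_on S) \<and> continuous_on S (nth_deriv_on S k g)"

definition smooth_on :: "real set \<Rightarrow> (real \<Rightarrow> real) \<Rightarrow> bool" where
  "smooth_on S g \<longleftrightarrow> (\<forall>k. Ck_on k S g)"

text \<open>
  A real-valued supremum, so meaningful only for functions bounded on a nonempty set; it is only
  applied to continuous functions on compact intervals.
\<close>

definition sup_norm_on :: "real set \<Rightarrow> (real \<Rightarrow> real) \<Rightarrow> real" where
  "sup_norm_on S g = (SUP x\<in>S. \<bar>g x\<bar>)"

definition local_max_on :: "real set \<Rightarrow> (real \<Rightarrow> real) \<Rightarrow> real \<Rightarrow> bool" where
  "local_max_on S g a \<longleftrightarrow> a \<in> S \<and> (\<exists>e>0. \<forall>x\<in>S. \<bar>x - a\<bar> < e \<longrightarrow> g x \<le> g a)"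

definition local_min_on :: "real set \<Rightarrow> (real \<Rightarrow> real) \<Rightarrow> real \<Rightarrow> bool" where
  "local_min_on S g a \<longleftrightarrow> a \<in> S \<and> (\<exists>e>0. \<forall>x\<in>S. \<bar>x - a\<bar> < e \<longrightarrow> g a \<le> g x)"


section \<open>Local entropy\<close>

text \<open>
  The phase space is a subset \<open>X\<close> of a metric space type, with the induced distance;
  \<open>T\<close> is a self-map of \<open>X\<close>, and its values outside \<open>X\<close> are irrelevant.
\<close>

definition bowen_ball ::
    "'a::metric_space set \<Rightarrow> ('a \<Rightarrow> 'a) \<Rightarrow> nat \<Rightarrow> 'a \<Rightarrow> real \<Rightarrow> 'a set" where
  "bowen_ball X T n x \<rho> = {y \<in> X. \<forall>k<n. dist ((T ^^ k) y) ((T ^^ k) x) < \<rho>}"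

definition separated_set :: "('a::metric_space \<Rightarrow> 'a) \<Rightarrow> real \<Rightarrow> nat \<Rightarrow> 'a set \<Rightarrow> bool" where
  "separated_set T \<epsilon> n E \<longleftrightarrow>
     (\<forall>y\<in>E. \<forall>y'\<in>E. y \<noteq> y' \<longrightarrow> (\<exists>k<n. dist ((T ^^ k) y) ((T ^^ k) y') > \<epsilon>))"

text \<open>
  The supremum is a maximum when \<open>T\<close> is continuous on a compact \<open>X \<supseteq> Y\<close>, \<open>\<epsilon> > 0\<close> and \<open>n \<ge> 1\<close>:
  then every separated subset of \<open>Y\<close> is finite and the cardinalities are bounded.
\<close>

definition sep_number :: "('a::metric_space \<Rightarrow> 'a) \<Rightarrow> nat \<Rightarrow> real \<Rightarrow> 'a set \<Rightarrow> nat" where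
  "sep_number T n \<epsilon> Y = (SUP E\<in>{E. E \<subseteq> Y \<and> finite E \<and> separated_set T \<epsilon> n E}. card E)"

text \<open>
  Both limits are monotone in their variable, so they exist in the extended reals.
\<close>

definition local_entropy :: "'a::metric_space set \<Rightarrow> ('a \<Rightarrow> 'a) \<Rightarrow> ereal" where
  "local_entropy X T =
     Lim (at_right 0) (\<lambda>\<epsilon>::real. Lim (at_right 0) (\<lambda>\<eta>::real.
       limsup (\<lambda>n. ereal (1 / real n) *
         (SUP x\<in>X. ereal (ln (real (sep_number T n \<eta> (bowen_ball X T n x \<epsilon>))))))))"

definition growth_rate :: "real set \<Rightarrow> (real \<Rightarrow> real) \<Rightarrow> real" where
  "growth_rate S f = (INF k\<in>{1::nat..}. root k (sup_norm_on S (deriv_on S (f ^^ k))))"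


section \<open>The interval maps\<close>

definition delta :: "real \<Rightarrow> nat \<Rightarrow> real" where
  "delta lam r = lam powi (- int r)"

definition curv :: "real \<Rightarrow> nat \<Rightarrow> real" where
  "curv lam r = 1 / (4 * (delta lam r)\<^sup>2)"

definition x_pt :: "nat \<Rightarrow> real" where
  "x_pt n = 1 + 1 / real n"

definition y_pt :: "nat \<Rightarrow> real" where
  "y_pt n = x_pt n + 1 / (2 * (real n)\<^sup>2)"

definition M_num :: "real \<Rightarrow> nat \<Rightarrow> int" where
  "M_num lam n = 2 * \<lfloor>lam ^ n / (2 * (real n)\<^sup>2)\<rfloor> - 1"

definition m_num :: "nat \<Rightarrow> real" where
  "m_num n = 1 - 1 / (real n + 1)\<^sup>2"

definition k_slope :: "real \<Rightarrow> nat \<Rightarrow> nat \<Rightarrow> real" where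
  "k_slope lam r n = 2 * lam ^ r / real_of_int (M_num lam n)"

definition w_pt :: "real \<Rightarrow> nat \<Rightarrow> nat \<Rightarrow> real" where
  "w_pt lam r n = y_pt (n + 1) + (real n + 2) /
     (2 * real n * (real n + 1)\<^sup>2 * real_of_int (M_num lam (n + 1)) * k_slope lam r (n + 1))"

text \<open>
  Conditions on a single oscillating function \<open>g = s\<^sub>n\<close> on \<open>[0, M\<^sub>n]\<close>. End points count as local
  extrema of \<open>g\<close> on its domain, which is why \<open>M\<^sub>n\<close> and \<open>0\<close> are excluded in the quadratic
  conditions.
\<close>

definition oscillating :: "real \<Rightarrow> nat \<Rightarrow> nat \<Rightarrow> (real \<Rightarrow> real) \<Rightarrow> bool" where
  "oscillating lam r n g \<longleftrightarrow>
    (let \<delta> = delta lam r; C = curv lam r; m = m_num n; \<kappa> = k_slope lam r n;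
         Mi = M_num lam n; M = real_of_int Mi; D = {0..M}
     in smooth_on D g \<and> g \<in> D \<rightarrow> {- m..1} \<and> g 0 = 0 \<and> g M = 1 \<and>
        (\<forall>k::int. 0 \<le> k \<and> 2 * k \<le> Mi - 1 \<longrightarrow>
            strict_mono_on {2 * real_of_int k..2 * real_of_int k + 1} g) \<and>
        (\<forall>k::int. 0 \<le> k \<and> 2 * k \<le> Mi - 3 \<longrightarrow>
            strict_antimono_on {2 * real_of_int k + 1..2 * real_of_int k + 2} g) \<and>
        (\<forall>a. local_max_on D g a \<and> a \<noteq> M \<longrightarrow>
            (\<forall>x. \<bar>x - a\<bar> \<le> \<delta> \<longrightarrow> g x = 1 - C * (x - a)\<^sup>2)) \<and>
        (\<forall>b. local_min_on D g b \<and> b \<noteq> 0 \<longrightarrow>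
            (\<forall>x. \<bar>x - b\<bar> \<le> \<delta> \<longrightarrow> g x = - m + C * (x - b)\<^sup>2)) \<and>
        (\<forall>x. M - \<delta> \<le> x \<and> x \<le> M \<longrightarrow> g x = \<kappa> * (x - M) + 1) \<and>
        (\<forall>x. 0 \<le> x \<and> x \<le> \<delta> \<longrightarrow> g x = \<kappa> * x) \<and>
        sup_norm_on D (deriv_on D g) \<le> lam ^ r \<and>
        (\<forall>x\<in>D. (\<forall>d. (local_max_on D g d \<or> local_min_on D g d) \<and> 0 < d \<and> d < M
                      \<longrightarrow> \<delta> \<le> \<bar>x - d\<bar>)
            \<longrightarrow> min (1 / 2) \<kappa> \<le> \<bar>deriv_on D g x\<bar>))"

text \<open>
  Conditions on a single transition function \<open>p = \<phi>\<^sub>n\<close> on \<open>[0, 1]\<close>, where \<open>l\<close> and \<open>h\<close> stand for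
  \<open>l\<^sub>n\<close> and \<open>h\<^sub>n\<close>.
\<close>

definition transition :: "real \<Rightarrow> nat \<Rightarrow> nat \<Rightarrow> real \<Rightarrow> real \<Rightarrow> (real \<Rightarrow> real) \<Rightarrow> bool" where
  "transition lam r n l h p \<longleftrightarrow>
    (let D = {0..1} in
        smooth_on D p \<and> p \<in> D \<rightarrow> {0..1} \<and> p 0 = 0 \<and> p 1 = 1 \<and>
        deriv_on D p 0 = 2 * inverse h * l * lam powi (- (int n * int r)) \<and>
        deriv_on D p 1 = 2 * inverse h * l * lam powi (- ((int n - 1) * int r)) \<and>
        (\<forall>k\<ge>2. nth_deriv_on D k p 0 = 0 \<and> nth_deriv_on D k p 1 = 0) \<and>
        (\<forall>t\<in>D. 2 / 3 * deriv_on D p 0 \<le> deriv_on D p t \<and> deriv_on D p t \<le> lam ^ r))"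

definition part_a :: "real \<Rightarrow> nat \<Rightarrow> (real \<Rightarrow> real) \<Rightarrow> bool" where
  "part_a lam r f \<longleftrightarrow>
    (\<exists>s :: nat \<Rightarrow> real \<Rightarrow> real.
        (\<forall>n\<ge>1. oscillating lam r n (s n)) \<and>
        (\<forall>k\<ge>1. \<exists>A. \<forall>n\<ge>1.
            sup_norm_on {0..real_of_int (M_num lam n)}
              (nth_deriv_on {0..real_of_int (M_num lam n)} k (s n)) \<le> A) \<and>
        (\<forall>n\<ge>1. \<forall>x\<in>{x_pt n..y_pt n}.
            f x = lam powi (- (int n * int r)) *
              (x_pt n + (y_pt n - x_pt n) *
                 s n (real_of_int (M_num lam n) * ((x - x_pt n) / (y_pt n - x_pt n))))))"

definition part_b :: "real \<Rightarrow> nat \<Rightarrow> (real \<Rightarrow> real) \<Rightarrow> bool" where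
  "part_b lam r f \<longleftrightarrow>
    (\<forall>n\<ge>1. \<forall>x\<in>{y_pt (n + 1)..w_pt lam r n}.
        f x = lam powi (- ((int n + 1) * int r)) * y_pt (n + 1) +
              lam powi (- ((int n + 1) * int r)) * real_of_int (M_num lam (n + 1)) *
                k_slope lam r (n + 1) * (x - y_pt (n + 1))) \<and>
    (\<exists>\<phi> :: nat \<Rightarrow> real \<Rightarrow> real.
        (\<forall>n\<ge>1. let w = w_pt lam r n; l = x_pt n - w; h = f (x_pt n) - f w
           in transition lam r n l h (\<phi> n) \<and>
              (\<forall>t\<in>{0..1}. f (w + l * t) = f w + h * \<phi> n t)) \<and>
        (\<forall>k\<ge>1. \<exists>B. \<forall>n\<ge>1. sup_norm_on {0..1} (nth_deriv_on {0..1} k (\<phi> n)) \<le> B))"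

definition part_c :: "real \<Rightarrow> nat \<Rightarrow> (real \<Rightarrow> real) \<Rightarrow> bool" where
  "part_c lam r f \<longleftrightarrow>
    (let \<delta> = delta lam r; f' = deriv_on {0..4} f in
      (\<forall>x. 0 \<le> x \<and> x \<le> 5 / 2 * \<delta> \<longrightarrow> f x = lam ^ r * x) \<and>
      (\<forall>x. \<bar>x - 1 / 2\<bar> \<le> \<delta> \<longrightarrow> f x = 4 - 3 / 2 * inverse \<delta> * (x - 1 / 2)\<^sup>2) \<and>
      (\<forall>x. 1 - \<delta> \<le> x \<and> x \<le> 1 \<longrightarrow> f x = \<delta> powi (1 - 2 * int r) * (x - 1) ^ (2 * r)) \<and>
      (\<forall>x. 4 - 3 / 2 * \<delta> \<le> x \<and> x \<le> 4 \<longrightarrow> f x = 4 + lam ^ r * (x - 4)) \<and>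
      (\<forall>x\<in>{5 / 2 * \<delta>..1 / 2 - \<delta>}. 3 / 2 \<le> f' x \<and> f' x \<le> lam ^ r) \<and>
      (\<forall>x\<in>{1 / 2 + \<delta>..1 - \<delta>}. - (lam ^ r) \<le> f' x \<and> f' x \<le> - (3 / 2)) \<and>
      (\<forall>x\<in>{y_pt 1..4}. 3 / 2 \<le> f' x \<and> f' x \<le> lam ^ r))"

text \<open>
  The pieces of \<open>f\<close> that are left free are constrained by the derivative bounds and by smoothness
  away from \<open>1\<close>, which expresses that all pieces are glued smoothly.
\<close>

definition is_f_map :: "real \<Rightarrow> nat \<Rightarrow> (real \<Rightarrow> real) \<Rightarrow> bool" where
  "is_f_map lam r f \<longleftrightarrow>
     f \<in> {0..4} \<rightarrow> {0..4} \<and> smooth_on ({0..4} - {1}) f \<and> Ck_on r {0..4} f \<and>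
     part_a lam r f \<and> part_b lam r f \<and> part_c lam r f"

end

theory Submission
  imports Defs "HOL-Real_Asymp.Real_Asymp"
begin

text \<open>
  The upper bound comes from the topological entropy: a Bowen ball is a subset of the phase space, so
  it suffices to count separated sets of the whole interval, and already these number at most
  \<open>lam\<^sup>N\<close> up to a polynomial factor. On a set on which the first \<open>N\<close> iterates are all monotone a
  separated set has only \<open>O(N)\<close> points (\<open>card_separated_le\<close>), so one has to cover \<open>[0, 4]\<close> by few
  such sets. Outside \<open>(1, y\<^sub>1)\<close> the map has seven monotone pieces. The interval \<open>[y\<^sub>n\<^sub>+\<^sub>1, y\<^sub>n]\<close>, called
  class \<open>n\<close> below, has \<open>M\<^sub>n + 2 \<le> 2 lam\<^sup>n / n\<^sup>2\<close> monotone pieces, but its image is so close to the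
  fixed point \<open>0\<close>, where \<open>f\<close> is multiplication by \<open>lam\<^sup>r\<close>, that the next \<open>n\<close> steps are linear and do
  not fold. The images of the classes \<open>n \<ge> N + c\<close> do not leave a small neighbourhood of \<open>0\<close>
  within \<open>N\<close> steps, so that all these classes together cost a single set. The number \<open>l N\<close> of sets therefore obeys
  \<open>l N \<le> 7 l (N - 1) + (\<Sum>n. (2 lam\<^sup>n / n\<^sup>2) l (N - n - 1)) + 1\<close>, and since \<open>\<Sum>n. 1 / n\<^sup>2 \<le> 2\<close> and
  \<open>7 + 4 + 1 = 12 \<le> lam\<close>, a constant multiple of \<open>lam\<^sup>N\<close> is a solution (\<open>tame_cover_all\<close>).

  For the lower bound, \<open>f\<^sup>n\<^sup>+\<^sup>1\<close> restricted to \<open>[x\<^sub>n, y\<^sub>n]\<close> is \<open>s\<^sub>n\<close> in an affine coordinate, and each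
  increasing branch of \<open>s\<^sub>n\<close> covers \<open>[0, 1]\<close>. This is a horseshoe with about \<open>lam\<^sup>n / (2 n\<^sup>2)\<close>
  branches, all of whose orbits stay within \<open>1 / (2 n\<^sup>2)\<close> of the orbit of the periodic point \<open>x\<^sub>n\<close>.
  It contributes \<open>ln (lam\<^sup>n / (4 n\<^sup>2)) / (n + 1)\<close> at least to the local entropy at any scale above
  \<open>1 / (2 n\<^sup>2)\<close> (\<open>local_growth_ge_branches\<close>), which tends to \<open>ln lam\<close>.

  Finally \<open>\<bar>f'\<bar> \<le> lam\<^sup>r\<close> everywhere, with equality at the fixed point \<open>4\<close>; hence every term of the
  infimum defining the growth rate equals \<open>lam\<^sup>r\<close> (\<open>growth_rate_eq\<close>).
\<close>

section \<open>Local entropy from two-sided growth estimates\<close>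

definition local_growth ::
    "'a::metric_space set \<Rightarrow> ('a \<Rightarrow> 'a) \<Rightarrow> real \<Rightarrow> real \<Rightarrow> ereal" where
  "local_growth X T \<epsilon> \<eta> = limsup (\<lambda>n. ereal (1 / real n) *
     (SUP x\<in>X. ereal (ln (real (sep_number T n \<eta> (bowen_ball X T n x \<epsilon>))))))"

text \<open>
  The two estimates force the inner limit to be \<open>a\<close> for each single \<open>\<epsilon>\<close>, so that the outer limit is
  that of a constant.
\<close>

lemma local_entropy_eqI:
  fixes a :: real
  assumes upper: "\<And>\<epsilon> \<eta>. 0 < \<epsilon> \<Longrightarrow> 0 < \<eta> \<Longrightarrow> local_growth X T \<epsilon> \<eta> \<le> ereal a"
    and lower: "\<And>\<epsilon> c. 0 < \<epsilon> \<Longrightarrow> c < a \<Longrightarrow>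
      \<exists>\<eta>0>0. \<forall>\<eta>. 0 < \<eta> \<and> \<eta> < \<eta>0 \<longrightarrow> ereal c \<le> local_growth X T \<epsilon> \<eta>"
  shows "local_entropy X T = ereal a"
proof -
  have inner: "Lim (at_right 0) (local_growth X T \<epsilon>) = ereal a" if "0 < \<epsilon>" for \<epsilon>
  proof (rule tendsto_Lim)
    show "(local_growth X T \<epsilon> \<longlongrightarrow> ereal a) (at_right 0)"
    proof (rule order_tendstoI)
      fix c assume "c < ereal a"
      then obtain c' where c': "c < ereal c'" "c' < a"
        using ereal_dense2 by (metis less_ereal.simps(1))
      obtain \<eta>0 where "\<eta>0 > 0" "\<forall>\<eta>. 0 < \<eta> \<and> \<eta> < \<eta>0 \<longrightarrow> ereal c' \<le> local_growth X T \<epsilon> \<eta>"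
        using lower[OF \<open>0 < \<epsilon>\<close> c'(2)] by blast
      then show "\<forall>\<^sub>F \<eta> in at_right 0. c < local_growth X T \<epsilon> \<eta>"
        unfolding eventually_at_right_field using c'(1) by (meson less_le_trans)
    next
      fix c assume "ereal a < c"
      then show "\<forall>\<^sub>F \<eta> in at_right 0. local_growth X T \<epsilon> \<eta> < c"
        unfolding eventually_at_right_field
        using upper[OF \<open>0 < \<epsilon>\<close>] by (meson le_less_trans zero_less_one)
    qed
  qed simp
  have "Lim (at_right 0) (\<lambda>\<epsilon>. Lim (at_right 0) (local_growth X T \<epsilon>)) = ereal a"
  proof (rule tendsto_Lim)
    show "((\<lambda>\<epsilon>. Lim (at_right 0) (local_growth X T \<epsilon>)) \<longlongrightarrow> ereal a) (at_right 0)"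
      by (rule tendsto_eventually)
        (use inner in \<open>auto simp: eventually_at_right_field intro!: exI[of _ 1]\<close>)
  qed simp
  then show ?thesis
    by (simp add: local_entropy_def local_growth_def[abs_def])
qed

text \<open>
  Bowen balls are contained in the whole space, and the factor \<open>A * (B * N + 1)\<close> disappears in the
  exponential growth rate.
\<close>

lemma local_growth_le:
  fixes T :: "'a::metric_space \<Rightarrow> 'a"
  assumes "1 \<le> A" "1 \<le> L" "0 \<le> B"
    and card_le: "\<And>N E. finite E \<Longrightarrow> E \<subseteq> X \<Longrightarrow> separated_set T \<eta> N E \<Longrightarrow>
      real (card E) \<le> A * L ^ N * (B * real N + 1)"
  shows "local_growth X T \<epsilon> \<eta> \<le> ereal (ln L)"
proof -
  define b where "b N = (ln A + real N * ln L + ln (B * real N + 1)) / real N" for N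
  have le_b: "ereal (1 / real N) * (SUP x\<in>X. ereal (ln (real (sep_number T N \<eta> (bowen_ball X T N x \<epsilon>)))))
      \<le> ereal (b N)" if "N > 0" for N
  proof -
    define K where "K = A * L ^ N * (B * real N + 1)"
    have "1 \<le> A * L ^ N"
      using assms mult_mono[of 1 A 1 "L ^ N"] by simp
    then have "1 \<le> K"
      using assms mult_mono[of 1 "A * L ^ N" 1 "B * real N + 1"] by (simp add: K_def)
    have lnK: "ln K = ln A + real N * ln L + ln (B * real N + 1)"
    proof -
      have "B * real N + 1 > 0" using assms by (simp add: add_nonneg_pos)
      then show ?thesis using assms by (simp add: K_def ln_mult ln_realpow)
    qed
    have sep: "real (sep_number T N \<eta> (bowen_ball X T N x \<epsilon>)) \<le> K" for x
    proof -
      have "sep_number T N \<eta> (bowen_ball X T N x \<epsilon>) \<le> nat \<lfloor>K\<rfloor>"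
        unfolding sep_number_def
      proof (rule cSUP_least)
        show "{E. E \<subseteq> bowen_ball X T N x \<epsilon> \<and> finite E \<and> separated_set T \<eta> N E} \<noteq> {}"
          by (auto simp: separated_set_def intro!: exI[of _ "{}"])
        fix E assume "E \<in> {E. E \<subseteq> bowen_ball X T N x \<epsilon> \<and> finite E \<and> separated_set T \<eta> N E}"
        then have "real (card E) \<le> K"
          unfolding K_def by (intro card_le) (auto simp: bowen_ball_def)
        then show "card E \<le> nat \<lfloor>K\<rfloor>"
          by (simp add: le_nat_floor)
      qed
      then have "real (sep_number T N \<eta> (bowen_ball X T N x \<epsilon>)) \<le> real (nat \<lfloor>K\<rfloor>)"
        by simp
      also have "\<dots> \<le> K" using \<open>1 \<le> K\<close> by simp
      finally show ?thesis .
    qed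
    have "ln (real (sep_number T N \<eta> (bowen_ball X T N x \<epsilon>))) \<le> ln K" for x
    proof (cases "sep_number T N \<eta> (bowen_ball X T N x \<epsilon>) = 0")
      case True
      then show ?thesis using \<open>1 \<le> K\<close> by simp
    next
      case False
      then show ?thesis using sep[of x] by (intro ln_mono) auto
    qed
    then have "(SUP x\<in>X. ereal (ln (real (sep_number T N \<eta> (bowen_ball X T N x \<epsilon>))))) \<le> ereal (ln K)"
      by (intro SUP_least) simp
    then have "ereal (1 / real N) * (SUP x\<in>X. ereal (ln (real (sep_number T N \<eta> (bowen_ball X T N x \<epsilon>)))))
      \<le> ereal (1 / real N) * ereal (ln K)"
      by (intro ereal_mult_left_mono) auto
    also have "\<dots> = ereal (b N)" by (simp add: b_def lnK)
    finally show ?thesis .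
  qed
  have "b \<longlonglongrightarrow> ln L"
  proof (cases "B = 0")
    case True
    then show ?thesis unfolding b_def by simp real_asymp
  next
    case False
    then have "B > 0" using assms by simp
    then show ?thesis unfolding b_def by real_asymp
  qed
  then have lim: "limsup (\<lambda>N. ereal (b N)) = ereal (ln L)"
    by (intro lim_imp_Limsup) auto
  have "local_growth X T \<epsilon> \<eta> \<le> limsup (\<lambda>N. ereal (b N))"
    unfolding local_growth_def
    by (rule Limsup_mono) (use le_b in \<open>auto simp: eventually_sequentially intro!: exI[of _ 1]\<close>)
  then show ?thesis using lim by simp
qed

lemma card_le_sep_number:
  assumes "E \<subseteq> Y" "finite E" "separated_set T \<eta> n E"
    and "\<And>E. finite E \<Longrightarrow> E \<subseteq> Y \<Longrightarrow> separated_set T \<eta> n E \<Longrightarrow> real (card E) \<le> K"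
  shows "card E \<le> sep_number T n \<eta> Y"
  unfolding sep_number_def
proof (rule cSUP_upper)
  show "bdd_above (card ` {E. E \<subseteq> Y \<and> finite E \<and> separated_set T \<eta> n E})"
    using assms(4) by (auto intro!: bdd_aboveI[of _ "nat \<lfloor>K\<rfloor>"] le_nat_floor)
qed (use assms in auto)

text \<open>
  The growth rate is read off along the multiples of \<open>q\<close>. The bound \<open>K\<close> on all separated sets makes the
  supremum in the definition of the separation number a genuine upper bound.
\<close>

lemma local_growth_ge:
  fixes T :: "'a::metric_space \<Rightarrow> 'a"
  assumes "x0 \<in> X" "q \<ge> 1" "b \<ge> 1"
    and bounded: "\<And>N E. finite E \<Longrightarrow> E \<subseteq> X \<Longrightarrow> separated_set T \<eta> N E \<Longrightarrow> real (card E) \<le> K N"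
    and E: "\<And>j. \<exists>E. finite E \<and> E \<subseteq> bowen_ball X T (q * j) x0 \<epsilon> \<and> card E = b ^ j \<and>
      separated_set T \<eta> (q * j) E"
  shows "ereal (ln (real b) / real q) \<le> local_growth X T \<epsilon> \<eta>"
proof -
  define a where "a n = ereal (1 / real n) *
     (SUP x\<in>X. ereal (ln (real (sep_number T n \<eta> (bowen_ball X T n x \<epsilon>)))))" for n
  define s where "s j = q * Suc j" for j
  have "strict_mono s"
    using \<open>q \<ge> 1\<close> by (intro strict_monoI_Suc) (simp add: s_def)
  have "ereal (ln (real b) / real q) \<le> a (s j)" for j
  proof -
    obtain E where E': "finite E" "E \<subseteq> bowen_ball X T (s j) x0 \<epsilon>" "card E = b ^ Suc j"
        "separated_set T \<eta> (s j) E"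
      using E[of "Suc j"] unfolding s_def by blast
    have "bowen_ball X T (s j) x0 \<epsilon> \<subseteq> X" by (auto simp: bowen_ball_def)
    then have "b ^ Suc j \<le> sep_number T (s j) \<eta> (bowen_ball X T (s j) x0 \<epsilon>)"
      using card_le_sep_number[OF E'(2,1,4), of "K (s j)"] bounded E'(3) by (metis subset_trans)
    then have "real b ^ Suc j \<le> real (sep_number T (s j) \<eta> (bowen_ball X T (s j) x0 \<epsilon>))"
      by (metis of_nat_le_iff of_nat_power)
    then have "ln (real b ^ Suc j) \<le> ln (real (sep_number T (s j) \<eta> (bowen_ball X T (s j) x0 \<epsilon>)))"
      using \<open>b \<ge> 1\<close> by (intro ln_mono) auto
    then have "real (Suc j) * ln (real b) \<le>
        ln (real (sep_number T (s j) \<eta> (bowen_ball X T (s j) x0 \<epsilon>)))"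
      using \<open>b \<ge> 1\<close> by (subst (asm) ln_realpow) auto
    then have "ereal (real (Suc j) * ln (real b)) \<le>
        (SUP x\<in>X. ereal (ln (real (sep_number T (s j) \<eta> (bowen_ball X T (s j) x \<epsilon>)))))"
      using \<open>x0 \<in> X\<close> by (intro SUP_upper2[of x0]) auto
    then have "ereal (1 / real (s j)) * ereal (real (Suc j) * ln (real b)) \<le> a (s j)"
      unfolding a_def by (intro ereal_mult_left_mono) auto
    moreover have "1 / real (s j) * (real (Suc j) * ln (real b)) = ln (real b) / real q"
      using \<open>q \<ge> 1\<close> unfolding s_def of_nat_mult
      by (simp add: divide_simps del: of_nat_Suc)
    ultimately show ?thesis by simp
  qed
  then have "ereal (ln (real b) / real q) \<le> limsup (a \<circ> s)"
    by (intro le_Limsup) auto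
  also have "\<dots> \<le> limsup a" by (rule limsup_subseq_mono) fact
  finally show ?thesis by (simp add: a_def[abs_def] local_growth_def)
qed

section \<open>Counting separated points by monotone pieces\<close>

text \<open>
  An iterate may also be so small in oscillation that it separates no points at scale \<open>\<eta>\<close>; this
  alternative absorbs regions with infinitely many folds.
\<close>

definition tame :: "(real \<Rightarrow> real) \<Rightarrow> real \<Rightarrow> nat \<Rightarrow> real set \<Rightarrow> bool" where
  "tame T \<eta> N J \<longleftrightarrow> (\<forall>k<N. mono_on J (T ^^ k) \<or> antimono_on J (T ^^ k) \<or>
     (\<forall>x\<in>J. \<forall>y\<in>J. \<bar>(T ^^ k) x - (T ^^ k) y\<bar> \<le> \<eta>))"

text \<open>
  Adding up the iterates, with the sign of those that decrease reversed and the non-separating ones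
  dropped, gives a function \<open>V\<close> that increases by more than \<open>\<eta>\<close> between any two points of a separated
  set, while its values on the set differ by at most \<open>(v - u) * N\<close>. Rounding \<open>V / \<eta>\<close> is thus injective.
\<close>

lemma card_separated_le:
  fixes T :: "real \<Rightarrow> real"
  assumes "finite E" "E \<subseteq> J" and tame: "tame T \<eta> N J" and sep: "separated_set T \<eta> N E"
    and range: "\<And>k x. k < N \<Longrightarrow> x \<in> E \<Longrightarrow> (T ^^ k) x \<in> {u..v}"
    and "\<eta> > 0" "u \<le> v"
  shows "real (card E) \<le> (v - u) / \<eta> * real N + 1"
proof (cases "E = {}")
  case True
  then show ?thesis using assms by simp
next
  case False
  define \<sigma> :: "nat \<Rightarrow> real" where
    "\<sigma> k = (if mono_on J (T ^^ k) then 1 else if antimono_on J (T ^^ k) then -1 else 0)" for k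
  define V where "V x = (\<Sum>k<N. \<sigma> k * (T ^^ k) x)" for x
  have V_diff: "V y - V x = (\<Sum>k<N. \<sigma> k * ((T ^^ k) y - (T ^^ k) x))" for x y
    by (simp add: V_def right_diff_distrib sum_subtractf)
  have term_nonneg: "0 \<le> \<sigma> k * ((T ^^ k) y - (T ^^ k) x)"
    if "x \<in> E" "y \<in> E" "x < y" for x y k
    using that \<open>E \<subseteq> J\<close> by (auto simp: \<sigma>_def monotone_on_def subset_iff)
  have V_gap: "\<eta> < V y - V x" if xy: "x \<in> E" "y \<in> E" "x < y" for x y
  proof -
    obtain k where k: "k < N" "\<bar>(T ^^ k) x - (T ^^ k) y\<bar> > \<eta>"
      using sep xy unfolding separated_set_def dist_real_def by force
    then have "mono_on J (T ^^ k) \<or> antimono_on J (T ^^ k)"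
      using tame xy \<open>E \<subseteq> J\<close> unfolding tame_def by (meson not_le subsetD)
    then have "\<bar>\<sigma> k * ((T ^^ k) y - (T ^^ k) x)\<bar> > \<eta>"
      using k by (auto simp: \<sigma>_def)
    then have "\<eta> < \<sigma> k * ((T ^^ k) y - (T ^^ k) x)"
      using term_nonneg[OF xy, of k] by simp
    also have "\<dots> \<le> V y - V x"
      unfolding V_diff using k term_nonneg[OF xy] by (intro member_le_sum) auto
    finally show ?thesis .
  qed
  have V_le: "V y - V x \<le> (v - u) * real N" if "x \<in> E" "y \<in> E" for x y
  proof -
    have "V y - V x \<le> (\<Sum>k<N. v - u)"
      unfolding V_diff
    proof (rule sum_mono)
      fix k assume "k \<in> {..<N}"
      then have "(T ^^ k) x \<in> {u..v}" "(T ^^ k) y \<in> {u..v}"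
        using range that by auto
      then show "\<sigma> k * ((T ^^ k) y - (T ^^ k) x) \<le> v - u"
        by (auto simp: \<sigma>_def)
    qed
    then show ?thesis by (simp add: mult.commute)
  qed
  define x0 where "x0 = Min E"
  have x0: "x0 \<in> E" "\<And>x. x \<in> E \<Longrightarrow> x0 \<le> x"
    using \<open>finite E\<close> False by (auto simp: x0_def)
  have V0: "0 \<le> V x - V x0" if "x \<in> E" for x
    using x0(2)[OF that] V_gap[OF x0(1) that] \<open>\<eta> > 0\<close> by (cases "x = x0") auto
  define code where "code x = nat \<lfloor>(V x - V x0) / \<eta>\<rfloor>" for x
  have code_less: "code x < code y" if xy: "x \<in> E" "y \<in> E" "x < y" for x y
  proof -
    have "(V x - V x0) / \<eta> + 1 \<le> (V y - V x0) / \<eta>"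
    proof -
      have "(V x - V x0) / \<eta> + 1 = (V x + \<eta> - V x0) / \<eta>"
        using \<open>\<eta> > 0\<close> by (simp add: field_simps)
      also have "\<dots> \<le> (V y - V x0) / \<eta>"
        using V_gap[OF xy] \<open>\<eta> > 0\<close> by (intro divide_right_mono) auto
      finally show ?thesis .
    qed
    moreover have "0 \<le> (V x - V x0) / \<eta>"
      using V0[OF xy(1)] \<open>\<eta> > 0\<close> by simp
    ultimately show ?thesis unfolding code_def by linarith
  qed
  have "inj_on code E"
  proof (rule inj_onI)
    fix x y assume "x \<in> E" "y \<in> E" "code x = code y"
    then show "x = y" using code_less[of x y] code_less[of y x] by (cases x y rule: linorder_cases) auto
  qed
  moreover have "code ` E \<subseteq> {..nat \<lfloor>(v - u) / \<eta> * real N\<rfloor>}"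
  proof safe
    fix x assume "x \<in> E"
    then have "(V x - V x0) / \<eta> \<le> (v - u) * real N / \<eta>"
      using V_le[OF x0(1)] \<open>\<eta> > 0\<close> by (intro divide_right_mono) auto
    then have "(V x - V x0) / \<eta> \<le> (v - u) / \<eta> * real N" by simp
    then show "code x \<le> nat \<lfloor>(v - u) / \<eta> * real N\<rfloor>"
      unfolding code_def by (intro nat_mono floor_mono)
  qed
  ultimately have "card E \<le> nat \<lfloor>(v - u) / \<eta> * real N\<rfloor> + 1"
    by (metis card_inj_on_le card_atMost finite_atMost Suc_eq_plus1)
  moreover have "0 \<le> (v - u) / \<eta> * real N" using assms by simp
  ultimately show ?thesis by linarith
qed

text \<open>
  The bound on the number of sets is real, since it will be a sum of terms such as
  \<open>lam\<^sup>N / n\<^sup>2\<close>.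
\<close>

definition tame_cover :: "(real \<Rightarrow> real) \<Rightarrow> real \<Rightarrow> nat \<Rightarrow> real set \<Rightarrow> real \<Rightarrow> bool" where
  "tame_cover T \<eta> N A c \<longleftrightarrow>
     (\<exists>F. finite F \<and> real (card F) \<le> c \<and> A \<subseteq> \<Union>F \<and> (\<forall>J\<in>F. tame T \<eta> N J))"

lemma tame_coverI: "tame T \<eta> N A \<Longrightarrow> 1 \<le> c \<Longrightarrow> tame_cover T \<eta> N A c"
  unfolding tame_cover_def by (intro exI[of _ "{A}"]) simp

lemma tame_cover_mono: "tame_cover T \<eta> N A c \<Longrightarrow> B \<subseteq> A \<Longrightarrow> c \<le> d \<Longrightarrow> tame_cover T \<eta> N B d"
  unfolding tame_cover_def by (meson order_trans)

lemma tame_cover_Un: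
  assumes "tame_cover T \<eta> N A c" "tame_cover T \<eta> N B d"
  shows "tame_cover T \<eta> N (A \<union> B) (c + d)"
proof -
  obtain F G where "finite F" "real (card F) \<le> c" "A \<subseteq> \<Union>F" "\<forall>J\<in>F. tame T \<eta> N J"
    "finite G" "real (card G) \<le> d" "B \<subseteq> \<Union>G" "\<forall>J\<in>G. tame T \<eta> N J"
    using assms unfolding tame_cover_def by blast
  moreover have "real (card (F \<union> G)) \<le> real (card F) + real (card G)"
    by (metis card_Un_le of_nat_add of_nat_le_iff)
  ultimately show ?thesis
    unfolding tame_cover_def by (intro exI[of _ "F \<union> G"]) auto
qed

lemma tame_cover_UN:
  assumes "finite I" "\<And>i. i \<in> I \<Longrightarrow> tame_cover T \<eta> N (A i) (c i)"
  shows "tame_cover T \<eta> N (\<Union>i\<in>I. A i) (\<Sum>i\<in>I. c i)"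
  using assms
proof (induction I rule: finite_induct)
  case empty
  then show ?case by (auto simp: tame_cover_def)
next
  case (insert i I)
  then show ?case using tame_cover_Un[of T \<eta> N "A i" "c i"] by simp
qed

text \<open>
  The recursion step for counting: up to time \<open>\<tau>\<close> nothing folds on \<open>P\<close>, so pulling back a cover for the
  remaining time by the monotone map \<open>T ^^ \<tau>\<close> keeps every later iterate monotone or small.
\<close>

lemma tame_cover_pullback:
  assumes mono: "\<And>k. k \<le> \<tau> \<Longrightarrow> mono_on P (T ^^ k) \<or> antimono_on P (T ^^ k)"
    and into: "(T ^^ \<tau>) ` P \<subseteq> X" and "\<tau> \<le> N"
    and cover: "tame_cover T \<eta> (N - \<tau>) X c"
  shows "tame_cover T \<eta> N P c"
proof -
  obtain F where F: "finite F" "real (card F) \<le> c" "X \<subseteq> \<Union>F" "\<forall>J\<in>F. tame T \<eta> (N - \<tau>) J"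
    using cover unfolding tame_cover_def by blast
  have "tame T \<eta> N (P \<inter> (T ^^ \<tau>) -` J)" if "J \<in> F" for J
    unfolding tame_def
  proof (intro allI impI)
    fix k assume "k < N"
    let ?Q = "P \<inter> (T ^^ \<tau>) -` J"
    show "mono_on ?Q (T ^^ k) \<or> antimono_on ?Q (T ^^ k) \<or>
      (\<forall>x\<in>?Q. \<forall>y\<in>?Q. \<bar>(T ^^ k) x - (T ^^ k) y\<bar> \<le> \<eta>)"
    proof (cases "k \<le> \<tau>")
      case True
      then show ?thesis using mono[of k] by (auto simp: monotone_on_def)
    next
      case False
      then have k: "T ^^ k = (T ^^ (k - \<tau>)) \<circ> (T ^^ \<tau>)"
        by (simp flip: funpow_add)
      have "k - \<tau> < N - \<tau>" using \<open>k < N\<close> False by simp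
      then have "mono_on J (T ^^ (k - \<tau>)) \<or> antimono_on J (T ^^ (k - \<tau>)) \<or>
        (\<forall>x\<in>J. \<forall>y\<in>J. \<bar>(T ^^ (k - \<tau>)) x - (T ^^ (k - \<tau>)) y\<bar> \<le> \<eta>)"
        using F(4) that unfolding tame_def by blast
      then show ?thesis
        using mono[of \<tau>] unfolding k by (auto simp: monotone_on_def)
    qed
  qed
  moreover have "P \<subseteq> \<Union>((\<lambda>J. P \<inter> (T ^^ \<tau>) -` J) ` F)"
    using into F(3) by blast
  moreover have "real (card ((\<lambda>J. P \<inter> (T ^^ \<tau>) -` J) ` F)) \<le> c"
    using card_image_le[OF F(1)] F(2) by (meson of_nat_le_iff order_trans)
  ultimately show ?thesis
    unfolding tame_cover_def using F(1)
    by (intro exI[of _ "(\<lambda>J. P \<inter> (T ^^ \<tau>) -` J) ` F"]) auto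
qed

lemma card_separated_le_tame_cover:
  assumes "tame_cover T \<eta> N {u..v} c" "T ` {u..v} \<subseteq> {u..v}" "\<eta> > 0" "u \<le> v"
    and "finite E" "E \<subseteq> {u..v}" "separated_set T \<eta> N E"
  shows "real (card E) \<le> c * ((v - u) / \<eta> * real N + 1)"
proof -
  obtain F where F: "finite F" "real (card F) \<le> c" "{u..v} \<subseteq> \<Union>F" "\<forall>J\<in>F. tame T \<eta> N J"
    using assms(1) unfolding tame_cover_def by blast
  have orbit: "(T ^^ k) x \<in> {u..v}" if "x \<in> {u..v}" for k x
    using that assms(2) by (induction k) (auto simp del: atLeastAtMost_iff)
  define K where "K = (v - u) / \<eta> * real N + 1"
  have "K \<ge> 0" using assms by (simp add: K_def)
  have "E = (\<Union>J\<in>F. E \<inter> J)" using assms(6) F(3) by auto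
  then have "card E \<le> (\<Sum>J\<in>F. card (E \<inter> J))"
    using card_UN_le[OF F(1), of "\<lambda>J. E \<inter> J"] by simp
  then have "real (card E) \<le> (\<Sum>J\<in>F. real (card (E \<inter> J)))"
    by (metis of_nat_le_iff of_nat_sum)
  also have "\<dots> \<le> (\<Sum>J\<in>F. K)"
  proof (rule sum_mono)
    fix J assume "J \<in> F"
    then show "real (card (E \<inter> J)) \<le> K"
      unfolding K_def using assms F(4) orbit
      by (intro card_separated_le[of "E \<inter> J" J T]) (auto simp: separated_set_def)
  qed
  also have "\<dots> \<le> c * K" using F(2) \<open>K \<ge> 0\<close> by (simp add: mult_right_mono)
  finally show ?thesis by (simp add: K_def)
qed

section \<open>Horseshoes\<close>

text \<open>
  The map \<open>p k\<close> is an inverse branch of \<open>F\<close>. The set for \<open>j\<close> consists of one point for each word of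
  length \<open>j\<close> in the branches; the points of two words come apart at the time of the first letter in which
  the words differ.
\<close>

lemma horseshoe_separated_sets:
  fixes F :: "'a::metric_space \<Rightarrow> 'a"
  assumes "J \<noteq> {}" "0 \<le> \<eta>"
    and p: "\<And>k u. k < b \<Longrightarrow> u \<in> J \<Longrightarrow> p k u \<in> J \<and> F (p k u) = u"
    and gap: "\<And>k k' u u'. k < b \<Longrightarrow> k' < b \<Longrightarrow> k \<noteq> k' \<Longrightarrow> u \<in> J \<Longrightarrow> u' \<in> J \<Longrightarrow>
      dist (p k u) (p k' u') > \<eta>"
  shows "\<exists>E. finite E \<and> card E = b ^ j \<and> (\<forall>x\<in>E. \<forall>i\<le>j. (F ^^ i) x \<in> J) \<and> separated_set F \<eta> j E"
proof (induction j)
  case 0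
  obtain a where "a \<in> J" using \<open>J \<noteq> {}\<close> by blast
  then show ?case by (intro exI[of _ "{a}"]) (simp add: separated_set_def)
next
  case (Suc j)
  then obtain E where E: "finite E" "card E = b ^ j" "\<forall>x\<in>E. \<forall>i\<le>j. (F ^^ i) x \<in> J"
    "separated_set F \<eta> j E" by blast
  have EJ: "x \<in> J" if "x \<in> E" for x using E(3) that by (metis funpow_0 le0)
  define g where "g = (\<lambda>(k, u). p k u)"
  define E' where "E' = g ` ({..<b} \<times> E)"
  have inj: "inj_on g ({..<b} \<times> E)"
  proof (rule inj_onI)
    fix z z' assume z: "z \<in> {..<b} \<times> E" "z' \<in> {..<b} \<times> E" "g z = g z'"
    then obtain k u k' u' where *: "z = (k, u)" "z' = (k', u')" "k < b" "u \<in> E" "k' < b" "u' \<in> E"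
      by auto
    with z have "p k u = p k' u'" by (simp add: g_def)
    moreover from this have "u = u'"
      using p[of k u] p[of k' u'] EJ * by metis
    ultimately show "z = z'"
      using gap[of k k' u u'] EJ * \<open>\<eta> \<ge> 0\<close> by fastforce
  qed
  show ?case
  proof (intro exI[of _ E'] conjI)
    show "finite E'" using E(1) by (simp add: E'_def)
    show "card E' = b ^ Suc j"
      using E(2) card_image[OF inj] by (simp add: E'_def card_cartesian_product)
    show "\<forall>x\<in>E'. \<forall>i\<le>Suc j. (F ^^ i) x \<in> J"
    proof (intro ballI allI impI)
      fix x i assume "x \<in> E'" "i \<le> Suc j"
      then obtain k u where x: "x = p k u" "k < b" "u \<in> E" by (auto simp: E'_def g_def)
      then show "(F ^^ i) x \<in> J"
        using p[of k u] EJ[of u] E(3) \<open>i \<le> Suc j\<close>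
        by (cases i) (auto simp: funpow_Suc_right simp del: funpow.simps(2))
    qed
    show "separated_set F \<eta> (Suc j) E'"
      unfolding separated_set_def
    proof (intro ballI impI)
      fix x x' assume "x \<in> E'" "x' \<in> E'" "x \<noteq> x'"
      then obtain k u k' u' where x: "x = p k u" "k < b" "u \<in> E" "x' = p k' u'" "k' < b" "u' \<in> E"
        by (auto simp: E'_def g_def)
      show "\<exists>i<Suc j. dist ((F ^^ i) x) ((F ^^ i) x') > \<eta>"
      proof (cases "u = u'")
        case True
        then have "dist x x' > \<eta>"
          using x gap[of k k' u u'] EJ \<open>x \<noteq> x'\<close> by auto
        then show ?thesis by (intro exI[of _ 0]) simp
      next
        case False
        then obtain i where "i < j" "dist ((F ^^ i) u) ((F ^^ i) u') > \<eta>"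
          using E(4) x unfolding separated_set_def by blast
        then show ?thesis
          using p[of k u] p[of k' u'] EJ x
          by (intro exI[of _ "Suc i"]) (auto simp: funpow_Suc_right simp del: funpow.simps(2))
      qed
    qed
  qed
qed

section \<open>Derivatives on intervals\<close>

lemma Ck_on_has_real_derivative:
  assumes "Ck_on k S g" "1 \<le> k" "x \<in> S"
  shows "(g has_real_derivative deriv_on S g x) (at x within S)"
proof -
  have "g differentiable_on S"
    using assms unfolding Ck_on_def nth_deriv_on_def by fastforce
  then show ?thesis
    using \<open>x \<in> S\<close> unfolding differentiable_on_def deriv_on_def
    by (simp add: vector_derivative_works has_real_derivative_iff_has_vector_derivative)
qed

lemma abs_deriv_on_le_sup_norm_on:
  assumes "Ck_on 1 S g" "compact S" "x \<in> S"
  shows "\<bar>deriv_on S g x\<bar> \<le> sup_norm_on S (deriv_on S g)"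
proof -
  have "continuous_on S (deriv_on S g)"
    using assms(1) by (simp add: Ck_on_def nth_deriv_on_def)
  then have "compact ((\<lambda>x. \<bar>deriv_on S g x\<bar>) ` S)"
    using \<open>compact S\<close> by (intro compact_continuous_image continuous_on_rabs)
  then have "bdd_above ((\<lambda>x. \<bar>deriv_on S g x\<bar>) ` S)"
    by (intro bounded_imp_bdd_above compact_imp_bounded)
  then show ?thesis
    unfolding sup_norm_on_def using \<open>x \<in> S\<close> by (intro cSUP_upper)
qed

lemma deriv_on_interval_eq:
  assumes "(g has_real_derivative D) (at x within {a..b})" "a < b" "x \<in> {a..b}"
  shows "deriv_on {a..b} g x = D"
  using assms unfolding deriv_on_def has_real_derivative_iff_has_vector_derivative
  by (metis vector_derivative_within_cbox box_real(2))

lemma deriv_eq_on_subinterval: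
  assumes "(g has_real_derivative D) (at x within S)"
    and "{a..b} \<subseteq> S" "a < b" "x \<in> {a..b}"
    and "(h has_real_derivative D') (at x within {a..b})" "\<And>z. z \<in> {a..b} \<Longrightarrow> g z = h z"
  shows "D = D'"
proof -
  have "(g has_real_derivative D) (at x within {a..b})"
    using assms(1,2) has_field_derivative_subset by blast
  moreover have "(g has_real_derivative D') (at x within {a..b})"
    using assms(4-6) by (intro has_field_derivative_transform_within[of h D' x "{a..b}" 1 g]) auto
  ultimately show ?thesis
    using deriv_on_interval_eq[OF _ assms(3,4)] by metis
qed

lemma has_real_derivative_rescale:
  assumes "(p has_real_derivative D) (at (m * (x - a)) within S)"
    and "\<And>z. z \<in> T \<Longrightarrow> m * (z - a) \<in> S"
  shows "((\<lambda>z. p (m * (z - a))) has_real_derivative D * m) (at x within T)"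
proof -
  have "(p has_real_derivative D) (at (m * (x - a)) within (\<lambda>z. m * (z - a)) ` T)"
    using assms by (intro has_field_derivative_subset[OF assms(1)]) auto
  moreover have "((\<lambda>z. m * (z - a)) has_real_derivative m) (at x within T)"
    by (auto intro!: derivative_eq_intros)
  ultimately show ?thesis
    using DERIV_image_chain[of p D "\<lambda>z. m * (z - a)" x T m] by (simp add: o_def)
qed

lemma mono_on_interval_if_deriv_nonneg:
  fixes g :: "real \<Rightarrow> real"
  assumes "\<And>x. x \<in> {a..b} \<Longrightarrow> (g has_real_derivative g' x) (at x within {a..b})"
    and "\<And>x. x \<in> {a..b} \<Longrightarrow> 0 \<le> g' x"
  shows "mono_on {a..b} g"
proof (rule monotone_onI)
  fix x y assume xy: "x \<in> {a..b}" "y \<in> {a..b}" "x \<le> y"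
  show "g x \<le> g y"
  proof (cases "x = y")
    case False
    have "\<exists>z\<in>{x<..<y}. g y - g x = g' z * (y - x)"
    proof (rule mvt_simple)
      show "x < y" using False xy by simp
      fix z assume "x \<le> z" "z \<le> y"
      then have "z \<in> {a..b}" "{x..y} \<subseteq> {a..b}" using xy by auto
      then have "(g has_real_derivative g' z) (at z within {x..y})"
        using assms(1) has_field_derivative_subset by blast
      then show "(g has_derivative (*) (g' z)) (at z within {x..y})"
        by (simp add: has_field_derivative_def)
    qed
    then obtain z where "z \<in> {x<..<y}" "g y - g x = g' z * (y - x)" by blast
    moreover from this have "0 \<le> g' z * (y - x)"
      using assms(2) xy by (intro mult_nonneg_nonneg) auto
    ultimately show ?thesis by simp
  qed simp
qed

lemma antimono_on_interval_if_deriv_nonpos: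
  fixes g :: "real \<Rightarrow> real"
  assumes "\<And>x. x \<in> {a..b} \<Longrightarrow> (g has_real_derivative g' x) (at x within {a..b})"
    and "\<And>x. x \<in> {a..b} \<Longrightarrow> g' x \<le> 0"
  shows "antimono_on {a..b} g"
proof -
  have "mono_on {a..b} (\<lambda>x. - g x)"
    using assms by (intro mono_on_interval_if_deriv_nonneg[where g' = "\<lambda>x. - g' x"])
      (auto intro: DERIV_minus)
  then show ?thesis by (auto simp: monotone_on_def)
qed

section \<open>Basic properties of the maps\<close>

text \<open>
  All polynomial corrections to the exponential quantities of the construction are absorbed by this
  inequality.
\<close>

lemma two_times_square_le_power:
  fixes l :: real
  assumes "14 \<le> l" "1 \<le> n"
  shows "2 * (real n + 1)\<^sup>2 \<le> l ^ n"
  using \<open>1 \<le> n\<close>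
proof (induction n rule: nat_induct_at_least)
  case base
  then show ?case using assms(1) by (simp add: power2_eq_square)
next
  case (Suc n)
  have "2 * (real (Suc n) + 1)\<^sup>2 \<le> 14 * (2 * (real n + 1)\<^sup>2)"
    using Suc by (simp add: power2_eq_square algebra_simps)
  also have "\<dots> \<le> l * l ^ n"
    using Suc assms(1) by (intro mult_mono) auto
  finally show ?case by simp
qed

lemma sum_inverse_squares_le: "(\<Sum>n\<in>{1..<m}. 1 / (real n)\<^sup>2) \<le> 2"
proof -
  have "(\<Sum>n\<in>{1..<Suc (Suc k)}. 1 / (real n)\<^sup>2) \<le> 2 - 1 / real (Suc k)" for k
  proof (induction k)
    case (Suc k)
    have "1 / (real (Suc (Suc k)))\<^sup>2 \<le> 1 / real (Suc k) - 1 / real (Suc (Suc k))"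
      by (simp add: divide_simps power2_eq_square)
    then show ?case using Suc by simp
  qed simp
  then have k: "(\<Sum>n\<in>{1..<Suc (Suc k)}. 1 / (real n)\<^sup>2) \<le> 2" for k
    using zero_le_divide_1_iff[of "real (Suc k)"] by (metis diff_le_eq le_add_same_cancel1 of_nat_0_le_iff order_trans)
  show ?thesis
  proof (cases "m \<le> 1")
    case True
    then show ?thesis by simp
  next
    case False
    then have "m = Suc (Suc (m - 2))" by simp
    then show ?thesis using k by metis
  qed
qed

locale f_map =
  fixes lam :: real and r :: nat and f :: "real \<Rightarrow> real"
  assumes lam: "14 \<le> lam" and r: "1 \<le> r" and is_f_map: "is_f_map lam r f"
begin

text \<open>
  The slope at the fixed points \<open>0\<close> and \<open>4\<close>, its inverse, and the number of increasing branches of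
  \<open>s\<^sub>n\<close>, so that \<open>M\<^sub>n = 2 * b n - 1\<close>.
\<close>

definition L :: real where "L = lam ^ r"
definition d :: real where "d = delta lam r"
definition b :: "nat \<Rightarrow> nat" where "b n = nat \<lfloor>lam ^ n / (2 * (real n)\<^sup>2)\<rfloor>"
abbreviation w :: "nat \<Rightarrow> real" where "w n \<equiv> w_pt lam r n"

lemma L_ge: "14 \<le> L"
  using lam r power_increasing[of 1 r lam] by (simp add: L_def)

lemma lam_le_L: "lam \<le> L"
  using lam r power_increasing[of 1 r lam] by (simp add: L_def)

lemma dL: "d * L = 1"
  using lam by (simp add: d_def delta_def L_def power_int_minus)

lemma d_pos: "0 < d"
  using dL L_ge by (smt (verit) mult_le_0_iff)

lemma d_le: "d \<le> 1 / 14"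
  using mult_left_mono[OF L_ge, of d] d_pos dL by simp

lemma inverse_d: "inverse d = L"
  using dL d_pos by (simp add: field_simps)

lemma dL_power: "d ^ n * L ^ n = 1" "L ^ n * d ^ n = 1"
  using dL by (simp_all flip: power_mult_distrib add: mult.commute)

lemma powi_eq: "lam powi (- (int n * int r)) = d ^ n"
proof -
  have "lam powi (- (int n * int r)) = inverse (lam ^ (n * r))"
    by (simp add: power_int_minus flip: of_nat_mult)
  also have "\<dots> = inverse L ^ n"
    by (simp add: L_def mult.commute[of n r] power_mult power_inverse)
  also have "inverse L = d" using inverse_d by (metis inverse_inverse_eq)
  finally show ?thesis .
qed

lemma powi_eq': "lam powi (- ((int n + 1) * int r)) = d ^ Suc n"
  using powi_eq[of "Suc n"] by (simp add: add.commute)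

lemma b_bounds:
  assumes "1 \<le> n"
  shows "1 \<le> b n" "lam ^ n / (4 * (real n)\<^sup>2) \<le> real (b n)" "2 * real (b n) \<le> lam ^ n / (real n)\<^sup>2"
    "real_of_int (M_num lam n) = 2 * real (b n) - 1"
proof -
  define z where "z = lam ^ n / (2 * (real n)\<^sup>2)"
  have "2 * (real n)\<^sup>2 \<le> 2 * (real n + 1)\<^sup>2" by (simp add: power2_eq_square algebra_simps)
  then have "2 * (real n)\<^sup>2 \<le> lam ^ n"
    using two_times_square_le_power[OF lam assms] by linarith
  then have "1 \<le> z" using assms by (simp add: z_def divide_simps)
  have bz: "b n = nat \<lfloor>z\<rfloor>" by (simp add: b_def z_def)
  then have b_eq: "real (b n) = real_of_int \<lfloor>z\<rfloor>" using \<open>1 \<le> z\<close> by simp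
  show "1 \<le> b n" using \<open>1 \<le> z\<close> bz by linarith
  have "1 \<le> \<lfloor>z\<rfloor>" using \<open>1 \<le> z\<close> by simp
  then have "1 \<le> real_of_int \<lfloor>z\<rfloor>" by linarith
  then have "z / 2 \<le> real (b n)"
    using real_of_int_floor_add_one_gt[of z] unfolding b_eq by linarith
  then show "lam ^ n / (4 * (real n)\<^sup>2) \<le> real (b n)" by (simp add: z_def)
  have "real (b n) \<le> z" unfolding b_eq by simp
  then show "2 * real (b n) \<le> lam ^ n / (real n)\<^sup>2" by (simp add: z_def field_simps)
  show "real_of_int (M_num lam n) = 2 * real (b n) - 1"
    using b_eq by (simp add: M_num_def z_def)
qed

lemma M_num_eq: "1 \<le> n \<Longrightarrow> M_num lam n = 2 * int (b n) - 1"
  using b_bounds(4)[of n] by linarith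

lemma pt_bounds:
  assumes "1 \<le> n"
  shows "1 < x_pt n" "x_pt n < y_pt n" "y_pt n \<le> 5 / 2" "y_pt (Suc n) < x_pt n"
proof -
  show "1 < x_pt n" "x_pt n < y_pt n" using assms by (auto simp: x_pt_def y_pt_def)
  have "1 / real n \<le> 1" "1 / (real n)\<^sup>2 \<le> 1" using assms by auto
  then show "y_pt n \<le> 5 / 2" by (simp add: x_pt_def y_pt_def)
  show "y_pt (Suc n) < x_pt n"
    using assms by (simp add: x_pt_def y_pt_def divide_simps power2_eq_square) (simp add: algebra_simps)
qed

lemma f_into: "x \<in> {0..4} \<Longrightarrow> f x \<in> {0..4}"
  using is_f_map by (auto simp: is_f_map_def)

lemma f_deriv: "x \<in> {0..4} \<Longrightarrow> (f has_real_derivative deriv_on {0..4} f x) (at x within {0..4})"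
  using is_f_map r by (auto simp: is_f_map_def intro: Ck_on_has_real_derivative)

lemma f_left: "\<lbrakk>0 \<le> x; x \<le> 5 / 2 * d\<rbrakk> \<Longrightarrow> f x = L * x"
  and f_half: "\<bar>x - 1 / 2\<bar> \<le> d \<Longrightarrow> f x = 4 - 3 / 2 * L * (x - 1 / 2)\<^sup>2"
  and f_one: "\<lbrakk>1 - d \<le> x; x \<le> 1\<rbrakk> \<Longrightarrow> f x = d powi (1 - 2 * int r) * (x - 1) ^ (2 * r)"
  and f_right: "\<lbrakk>4 - 3 / 2 * d \<le> x; x \<le> 4\<rbrakk> \<Longrightarrow> f x = 4 + L * (x - 4)"
  and f'_A: "x \<in> {5 / 2 * d..1 / 2 - d} \<Longrightarrow> 3 / 2 \<le> deriv_on {0..4} f x \<and> deriv_on {0..4} f x \<le> L"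
  and f'_B: "x \<in> {1 / 2 + d..1 - d} \<Longrightarrow> - L \<le> deriv_on {0..4} f x \<and> deriv_on {0..4} f x \<le> - (3 / 2)"
  and f'_C: "x \<in> {y_pt 1..4} \<Longrightarrow> 3 / 2 \<le> deriv_on {0..4} f x \<and> deriv_on {0..4} f x \<le> L"
  using is_f_map inverse_d unfolding is_f_map_def part_c_def Let_def L_def[symmetric] d_def[symmetric]
  by auto

lemma band:
  assumes "1 \<le> n"
  obtains g where "oscillating lam r n g"
    "\<And>x. x \<in> {x_pt n..y_pt n} \<Longrightarrow> f x = d ^ n * (x_pt n + (y_pt n - x_pt n) *
       g ((2 * real (b n) - 1) / (y_pt n - x_pt n) * (x - x_pt n)))"
  using is_f_map assms b_bounds(4)[OF assms]
  unfolding is_f_map_def part_a_def powi_eq by fastforce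

text \<open>
  The values at the integers come from the quadratic normal forms: by the alternating monotonicity an
  interior odd integer is a local maximum and a positive even integer a local minimum. Consequently each
  increasing branch covers \<open>[0, 1]\<close>.
\<close>

lemma oscillating_facts:
  assumes "1 \<le> n" "oscillating lam r n g"
  shows "smooth_on {0..2 * real (b n) - 1} g"
    and "t \<in> {0..2 * real (b n) - 1} \<Longrightarrow> \<bar>g t\<bar> \<le> 1"
    and "t \<in> {0..2 * real (b n) - 1} \<Longrightarrow> \<bar>deriv_on {0..2 * real (b n) - 1} g t\<bar> \<le> L"
    and "g 0 = 0"
    and "k < b n \<Longrightarrow> mono_on {2 * real k..2 * real k + 1} g"
    and "Suc k < b n \<Longrightarrow> antimono_on {2 * real k + 1..2 * real k + 2} g"
    and "k < b n \<Longrightarrow> g (2 * real k) \<le> 0"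
    and "k < b n \<Longrightarrow> g (2 * real k + 1) = 1"
proof -
  define M where "M = 2 * real (b n) - 1"
  note M = b_bounds(4)[OF assms(1), folded M_def] M_num_eq[OF assms(1)]
  note o = assms(2)[unfolded oscillating_def Let_def M(1)]
  from o show smooth: "smooth_on {0..2 * real (b n) - 1} g" unfolding M_def[symmetric] by blast
  have m: "0 \<le> m_num n" "m_num n \<le> 1" by (auto simp: m_num_def)
  have "g \<in> {0..M} \<rightarrow> {- m_num n..1}" using o by blast
  then show "t \<in> {0..2 * real (b n) - 1} \<Longrightarrow> \<bar>g t\<bar> \<le> 1"
    using m unfolding M_def[symmetric] by (fastforce simp: abs_le_iff)
  have sup: "sup_norm_on {0..M} (deriv_on {0..M} g) \<le> L" using o unfolding L_def by blast
  show "\<bar>deriv_on {0..2 * real (b n) - 1} g t\<bar> \<le> L" if "t \<in> {0..2 * real (b n) - 1}"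
    using abs_deriv_on_le_sup_norm_on[of "{0..M}" g t] smooth sup that
    unfolding M_def[symmetric] smooth_on_def by force
  show g0: "g 0 = 0" using o by blast
  have inc: "strict_mono_on {2 * real k..2 * real k + 1} g" if "k < b n" for k
  proof -
    have "\<forall>k::int. 0 \<le> k \<and> 2 * k \<le> M_num lam n - 1 \<longrightarrow>
      strict_mono_on {2 * real_of_int k..2 * real_of_int k + 1} g" using o by blast
    from this[rule_format, of "int k"] show ?thesis using that by (simp add: M(2))
  qed
  have dec: "strict_antimono_on {2 * real k + 1..2 * real k + 2} g" if "Suc k < b n" for k
  proof -
    have "\<forall>k::int. 0 \<le> k \<and> 2 * k \<le> M_num lam n - 3 \<longrightarrow>
      strict_antimono_on {2 * real_of_int k + 1..2 * real_of_int k + 2} g" using o by blast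
    from this[rule_format, of "int k"] show ?thesis using that by (simp add: M(2))
  qed
  show "mono_on {2 * real k..2 * real k + 1} g" if "k < b n"
    using inc[OF that] by (rule strict_mono_on_imp_mono_on)
  show "antimono_on {2 * real k + 1..2 * real k + 2} g" if "Suc k < b n"
    using dec[OF that] by (force simp: monotone_on_def order_le_less)
  show "g (2 * real k) \<le> 0" if "k < b n"
  proof (cases k)
    case (Suc j)
    have "local_min_on {0..M} g (2 * real k)"
      unfolding local_min_on_def
    proof (intro conjI exI[of _ 1] ballI impI)
      show "2 * real k \<in> {0..M}" using that by (simp add: M_def)
      fix x assume "x \<in> {0..M}" "\<bar>x - 2 * real k\<bar> < 1"
      then show "g (2 * real k) \<le> g x"
        using inc[OF that] dec[of j] that Suc
        by (cases "x = 2 * real k"; cases "x < 2 * real k") (auto simp: monotone_on_def less_imp_le)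
    qed simp
    moreover have "2 * real k \<noteq> 0" using Suc by simp
    ultimately have "\<forall>x. \<bar>x - 2 * real k\<bar> \<le> delta lam r \<longrightarrow>
        g x = - m_num n + curv lam r * (x - 2 * real k)\<^sup>2"
      using o by blast
    then have "g (2 * real k) = - m_num n"
      using d_pos by (auto simp: d_def)
    then show ?thesis using m by simp
  qed (simp add: g0)
  show "g (2 * real k + 1) = 1" if "k < b n"
  proof (cases "Suc k = b n")
    case True
    have "g M = 1" using o by blast
    moreover have "M = 2 * real k + 1" using True by (simp add: M_def flip: True)
    ultimately show ?thesis by simp
  next
    case False
    then have k: "Suc k < b n" using that by simp
    have "local_max_on {0..M} g (2 * real k + 1)"
      unfolding local_max_on_def
    proof (intro conjI exI[of _ 1] ballI impI)
      show "2 * real k + 1 \<in> {0..M}" using k by (simp add: M_def)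
      fix x assume "x \<in> {0..M}" "\<bar>x - (2 * real k + 1)\<bar> < 1"
      then show "g x \<le> g (2 * real k + 1)"
        using inc[OF that] dec[OF k]
        by (cases "x = 2 * real k + 1"; cases "x < 2 * real k + 1")
          (auto simp: monotone_on_def less_imp_le)
    qed simp
    moreover have "2 * real k + 1 \<noteq> M" using k by (simp add: M_def)
    ultimately have "\<forall>x. \<bar>x - (2 * real k + 1)\<bar> \<le> delta lam r \<longrightarrow>
        g x = 1 - curv lam r * (x - (2 * real k + 1))\<^sup>2"
      using o by blast
    then show ?thesis using d_pos by (auto simp: d_def)
  qed
qed

section \<open>Geometry of the gaps\<close>

lemma gap_affine:
  assumes "1 \<le> n" "x \<in> {y_pt (Suc n)..w n}"
  shows "f x = d ^ Suc n * y_pt (Suc n) + 2 * d ^ n * (x - y_pt (Suc n))"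
proof -
  have M: "real_of_int (M_num lam (Suc n)) \<noteq> 0"
    using b_bounds(1,4)[of "Suc n"] by auto
  have "f x = d ^ Suc n * y_pt (Suc n) + d ^ Suc n * real_of_int (M_num lam (Suc n)) *
      k_slope lam r (Suc n) * (x - y_pt (Suc n))"
    using is_f_map assms unfolding is_f_map_def part_b_def powi_eq' by simp
  also have "d ^ Suc n * real_of_int (M_num lam (Suc n)) * k_slope lam r (Suc n) = 2 * d ^ n"
    using M dL by (simp add: k_slope_def flip: L_def)
  finally show ?thesis .
qed

lemma gap_length: "1 \<le> n \<Longrightarrow> x_pt n - y_pt (Suc n) = (real n + 2) / (2 * real n * (real n + 1)\<^sup>2)"
proof -
  assume "1 \<le> n"
  have *: "1 + 1 / N - (1 + 1 / (N + 1) + 1 / (2 * (N + 1)\<^sup>2)) = (N + 2) / (2 * N * (N + 1)\<^sup>2)"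
    if "0 < N" for N :: real
    using that by (simp add: divide_simps power2_eq_square) (simp add: algebra_simps)
  show ?thesis
    using *[of "real n"] \<open>1 \<le> n\<close> by (simp add: x_pt_def y_pt_def add.commute)
qed

lemma w_eq:
  assumes "1 \<le> n"
  shows "w n = y_pt (Suc n) + d / 2 * (x_pt n - y_pt (Suc n))"
proof -
  have M: "real_of_int (M_num lam (Suc n)) \<noteq> 0"
    using b_bounds(1,4)[of "Suc n"] by auto
  have "2 * real n * (real n + 1)\<^sup>2 * real_of_int (M_num lam (Suc n)) * k_slope lam r (Suc n)
      = 2 * L * (2 * real n * (real n + 1)\<^sup>2)"
    using M by (simp add: k_slope_def flip: L_def)
  then have "w n = y_pt (Suc n) + (real n + 2) / (2 * L * (2 * real n * (real n + 1)\<^sup>2))"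
    by (simp only: w_pt_def Suc_eq_plus1)
  also have "(real n + 2) / (2 * L * (2 * real n * (real n + 1)\<^sup>2))
      = d / 2 * (x_pt n - y_pt (Suc n))"
  proof -
    have "1 / L = d" using dL L_ge by (simp add: field_simps)
    have "(real n + 2) / (2 * L * K) = 1 / L / 2 * ((real n + 2) / K)" for K by simp
    then show ?thesis unfolding gap_length[OF assms] \<open>1 / L = d\<close> .
  qed
  finally show ?thesis .
qed

lemma w_bounds:
  assumes "1 \<le> n"
  shows "y_pt (Suc n) < w n" "w n < x_pt n"
proof -
  define e where "e = x_pt n - y_pt (Suc n)"
  have "0 < e" using pt_bounds(4)[OF assms] by (simp add: e_def)
  moreover have "d / 2 * e < 1 * e"
    using d_le \<open>0 < e\<close> by (intro mult_strict_right_mono) auto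
  moreover have "0 < d / 2 * e" using d_pos \<open>0 < e\<close> by simp
  moreover have "w n = y_pt (Suc n) + d / 2 * e" "x_pt n = y_pt (Suc n) + e"
    by (simp_all add: w_eq[OF assms] e_def)
  ultimately show "y_pt (Suc n) < w n" "w n < x_pt n" by linarith+
qed

lemma f_x_pt: "1 \<le> n \<Longrightarrow> f (x_pt n) = d ^ n * x_pt n"
proof -
  assume n: "1 \<le> n"
  obtain g where g: "oscillating lam r n g"
    "\<And>x. x \<in> {x_pt n..y_pt n} \<Longrightarrow> f x = d ^ n * (x_pt n + (y_pt n - x_pt n) *
       g ((2 * real (b n) - 1) / (y_pt n - x_pt n) * (x - x_pt n)))"
    using band[OF n] by blast
  show ?thesis
    using g(2)[of "x_pt n"] pt_bounds(2)[OF n] oscillating_facts(4)[OF n g(1)] by simp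
qed

text \<open>
  After division by \<open>d\<^sup>n\<^sup>+\<^sup>1\<close> the affine part stretches \<open>[y\<^sub>n\<^sub>+\<^sub>1, w\<^sub>n]\<close> onto the whole gap
  \<open>[y\<^sub>n\<^sub>+\<^sub>1, x\<^sub>n]\<close>; this is the reason for the choice of \<open>w\<^sub>n\<close>.
\<close>

lemma f_w:
  assumes "1 \<le> n"
  shows "f (w n) = d ^ Suc n * x_pt n"
proof -
  have "f (w n) = d ^ Suc n * y_pt (Suc n) + 2 * d ^ n * (w n - y_pt (Suc n))"
    using gap_affine[OF assms, of "w n"] w_bounds(1)[OF assms] by simp
  also have "w n - y_pt (Suc n) = d / 2 * (x_pt n - y_pt (Suc n))"
    by (simp add: w_eq[OF assms])
  also have "d ^ Suc n * y_pt (Suc n) + 2 * d ^ n * (d / 2 * (x_pt n - y_pt (Suc n))) =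
      d ^ Suc n * x_pt n" by (simp add: right_diff_distrib)
  finally show ?thesis .
qed

lemma gap_transition:
  assumes "1 \<le> n"
  obtains \<phi> where "\<And>t. t \<in> {0..1} \<Longrightarrow> (\<phi> has_real_derivative deriv_on {0..1} \<phi> t) (at t within {0..1})"
    "\<And>t. t \<in> {0..1} \<Longrightarrow> 0 \<le> deriv_on {0..1} \<phi> t \<and> deriv_on {0..1} \<phi> t \<le> L"
    "\<And>x. x \<in> {w n..x_pt n} \<Longrightarrow>
       f x = f (w n) + (f (x_pt n) - f (w n)) * \<phi> (1 / (x_pt n - w n) * (x - w n))"
proof -
  define l where "l = x_pt n - w n"
  define h where "h = f (x_pt n) - f (w n)"
  have "l > 0" using w_bounds[OF assms] by (simp add: l_def)
  have "h = x_pt n * d ^ n * (1 - d)"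
    by (simp add: h_def f_x_pt[OF assms] f_w[OF assms] algebra_simps)
  then have "h > 0" using d_pos d_le pt_bounds(1)[OF assms] by simp
  obtain \<phi> where \<phi>: "transition lam r n l h \<phi>" "\<forall>t\<in>{0..1}. f (w n + l * t) = f (w n) + h * \<phi> t"
    using is_f_map assms unfolding is_f_map_def part_b_def Let_def h_def l_def by blast
  show ?thesis
  proof
    have "smooth_on {0..1} \<phi>" using \<phi>(1) by (simp add: transition_def Let_def)
    then show "(\<phi> has_real_derivative deriv_on {0..1} \<phi> t) (at t within {0..1})" if "t \<in> {0..1}" for t
      using that Ck_on_has_real_derivative[of 1] by (simp add: smooth_on_def)
    have "deriv_on {0..1} \<phi> 0 = 2 * inverse h * l * d ^ n"
      using \<phi>(1) by (simp add: transition_def Let_def powi_eq)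
    also have "\<dots> \<ge> 0" using \<open>h > 0\<close> \<open>l > 0\<close> d_pos by simp
    finally have "0 \<le> deriv_on {0..1} \<phi> 0" .
    then show "0 \<le> deriv_on {0..1} \<phi> t \<and> deriv_on {0..1} \<phi> t \<le> L" if "t \<in> {0..1}" for t
    proof -
      have "2 / 3 * deriv_on {0..1} \<phi> 0 \<le> deriv_on {0..1} \<phi> t \<and> deriv_on {0..1} \<phi> t \<le> lam ^ r"
        using \<phi>(1) that unfolding transition_def Let_def by blast
      then show ?thesis using \<open>0 \<le> deriv_on {0..1} \<phi> 0\<close> unfolding L_def by auto
    qed
    show "f x = f (w n) + (f (x_pt n) - f (w n)) * \<phi> (1 / (x_pt n - w n) * (x - w n))"
      if "x \<in> {w n..x_pt n}" for x
    proof -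
      have "1 / l * (x - w n) \<in> {0..1}" "w n + l * (1 / l * (x - w n)) = x"
        using that \<open>l > 0\<close> by (auto simp: l_def field_simps)
      then show ?thesis using \<phi>(2) unfolding h_def l_def by metis
    qed
  qed
qed

lemma gap_transition_deriv:
  assumes "1 \<le> n"
  obtains f' where "\<And>x. x \<in> {w n..x_pt n} \<Longrightarrow> (f has_real_derivative f' x) (at x within {w n..x_pt n})"
    "\<And>x. x \<in> {w n..x_pt n} \<Longrightarrow> 0 \<le> f' x \<and> f' x \<le> L"
proof -
  define l where "l = x_pt n - w n"
  define h where "h = f (x_pt n) - f (w n)"
  obtain \<phi> where \<phi>: "\<And>t. t \<in> {0..1} \<Longrightarrow> (\<phi> has_real_derivative deriv_on {0..1} \<phi> t) (at t within {0..1})"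
    "\<And>t. t \<in> {0..1} \<Longrightarrow> 0 \<le> deriv_on {0..1} \<phi> t \<and> deriv_on {0..1} \<phi> t \<le> L"
    "\<And>x. x \<in> {w n..x_pt n} \<Longrightarrow> f x = f (w n) + h * \<phi> (1 / l * (x - w n))"
    using gap_transition[OF assms] unfolding l_def h_def by blast
  have "l > 0" using w_bounds[OF assms] by (simp add: l_def)
  have h_eq: "h = x_pt n * d ^ n * (1 - d)"
    by (simp add: h_def f_x_pt[OF assms] f_w[OF assms] algebra_simps)
  then have "h > 0" using d_pos d_le pt_bounds(1)[OF assms] by simp
  \<comment> \<open>The transition interval is longer than its image, so rescaling does not increase slopes.\<close>
  have "h \<le> l"
  proof -
    define N where "N = real n"
    have N: "1 \<le> N" using assms by (simp add: N_def)
    have "d ^ n \<le> 1 / (2 * (N + 1)\<^sup>2)"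
    proof -
      have "2 * (N + 1)\<^sup>2 \<le> L ^ n"
        using two_times_square_le_power[OF L_ge assms] by (simp add: N_def)
      then have "d ^ n * (2 * (N + 1)\<^sup>2) \<le> 1"
        using mult_left_mono[of "2 * (N + 1)\<^sup>2" "L ^ n" "d ^ n"] dL_power(1)[of n] d_pos by simp
      moreover have "0 < 2 * (N + 1)\<^sup>2" using N by simp
      ultimately show ?thesis by (simp add: pos_le_divide_eq)
    qed
    then have "x_pt n * d ^ n \<le> (1 + 1 / N) * (1 / (2 * (N + 1)\<^sup>2))"
      unfolding x_pt_def N_def by (intro mult_left_mono) auto
    also have "\<dots> \<le> (N + 2) / (2 * N * (N + 1)\<^sup>2)"
    proof -
      have "(1 + 1 / N) * (1 / (2 * (N + 1)\<^sup>2)) = (N + 1) / (2 * N * (N + 1)\<^sup>2)"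
        using N by (simp add: field_simps)
      also have "\<dots> \<le> (N + 2) / (2 * N * (N + 1)\<^sup>2)"
        using N by (intro divide_right_mono) auto
      finally show ?thesis .
    qed
    finally have *: "x_pt n * d ^ n \<le> x_pt n - y_pt (Suc n)"
      by (simp add: gap_length[OF assms] N_def)
    have "h \<le> (x_pt n - y_pt (Suc n)) * (1 - d)"
      unfolding h_eq using * d_le by (intro mult_right_mono) auto
    also have "\<dots> \<le> (x_pt n - y_pt (Suc n)) * (1 - d / 2)"
      using d_pos pt_bounds(4)[OF assms] by (intro mult_left_mono) auto
    also have "\<dots> = l" by (simp add: l_def w_eq[OF assms] algebra_simps)
    finally show ?thesis .
  qed
  define f' where "f' x = h * (deriv_on {0..1} \<phi> (1 / l * (x - w n)) * (1 / l))" for x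
  have t: "1 / l * (x - w n) \<in> {0..1}" if "x \<in> {w n..x_pt n}" for x
    using that \<open>l > 0\<close> by (auto simp: l_def field_simps)
  show ?thesis
  proof
    show "(f has_real_derivative f' x) (at x within {w n..x_pt n})" if x: "x \<in> {w n..x_pt n}" for x
    proof -
      have "((\<lambda>x. \<phi> (1 / l * (x - w n))) has_real_derivative
          deriv_on {0..1} \<phi> (1 / l * (x - w n)) * (1 / l)) (at x within {w n..x_pt n})"
        by (rule has_real_derivative_rescale[OF \<phi>(1)[OF t[OF x]] t])
      then have "((\<lambda>x. f (w n) + h * \<phi> (1 / l * (x - w n))) has_real_derivative f' x)
          (at x within {w n..x_pt n})"
        unfolding f'_def by (auto intro!: derivative_eq_intros)
      then show ?thesis
        by (rule has_field_derivative_transform_within[OF _ zero_less_one x])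
          (rule \<phi>(3)[symmetric])
    qed
    show "0 \<le> f' x \<and> f' x \<le> L" if x: "x \<in> {w n..x_pt n}" for x
    proof -
      define D where "D = deriv_on {0..1} \<phi> (1 / l * (x - w n))"
      have D: "0 \<le> D" "D \<le> L" using \<phi>(2)[OF t[OF x]] by (auto simp: D_def)
      have "h / l * D \<le> 1 * L"
        using D \<open>h \<le> l\<close> \<open>l > 0\<close> \<open>h > 0\<close> by (intro mult_mono) auto
      moreover have "0 \<le> h / l * D" using D \<open>h > 0\<close> \<open>l > 0\<close> by simp
      ultimately show ?thesis by (simp add: f'_def D_def)
    qed
  qed
qed

section \<open>Monotone pieces\<close>

lemma gap_mono:
  assumes "1 \<le> n"
  shows "mono_on {y_pt (Suc n)..w n} f" "mono_on {w n..x_pt n} f"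
proof -
  show "mono_on {y_pt (Suc n)..w n} f"
    using gap_affine[OF assms] d_pos by (auto simp: monotone_on_def)
  obtain f' where "\<And>x. x \<in> {w n..x_pt n} \<Longrightarrow> (f has_real_derivative f' x) (at x within {w n..x_pt n})"
    "\<And>x. x \<in> {w n..x_pt n} \<Longrightarrow> 0 \<le> f' x \<and> f' x \<le> L"
    using gap_transition_deriv[OF assms] by blast
  then show "mono_on {w n..x_pt n} f"
    by (intro mono_on_interval_if_deriv_nonneg) auto
qed

text \<open>
  The affine coordinate on the band \<open>[x\<^sub>n, y\<^sub>n]\<close> at which \<open>s\<^sub>n\<close> is evaluated.
\<close>

definition bcoord :: "nat \<Rightarrow> real \<Rightarrow> real" where
  "bcoord n x = (2 * real (b n) - 1) / (y_pt n - x_pt n) * (x - x_pt n)"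

lemma bcoord_in:
  assumes "1 \<le> n" "x \<in> {x_pt n..y_pt n}"
  shows "bcoord n x \<in> {0..2 * real (b n) - 1}"
proof -
  have M: "0 \<le> 2 * real (b n) - 1" and y: "0 < y_pt n - x_pt n"
    using b_bounds(1)[OF assms(1)] pt_bounds(2)[OF assms(1)] by auto
  define t where "t = (x - x_pt n) / (y_pt n - x_pt n)"
  have "0 \<le> t" "t \<le> 1"
    using assms(2) y unfolding t_def by (simp_all add: pos_divide_le_eq)
  then have "0 \<le> (2 * real (b n) - 1) * t" "(2 * real (b n) - 1) * t \<le> 2 * real (b n) - 1"
    using M mult_left_le[of t "2 * real (b n) - 1"] by (auto intro: mult_nonneg_nonneg)
  moreover have "bcoord n x = (2 * real (b n) - 1) * t" by (simp add: bcoord_def t_def)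
  ultimately show ?thesis by simp
qed

lemma bcoord_mono: "1 \<le> n \<Longrightarrow> x \<le> z \<Longrightarrow> bcoord n x \<le> bcoord n z"
  using b_bounds(1)[of n] pt_bounds(2)[of n] unfolding bcoord_def
  by (intro mult_left_mono) auto

lemma band_piece_mono:
  assumes n: "1 \<le> n" and j: "j < 2 * b n - 1"
  shows "mono_on {x \<in> {x_pt n..y_pt n}. bcoord n x \<in> {real j..real j + 1}} f \<or>
     antimono_on {x \<in> {x_pt n..y_pt n}. bcoord n x \<in> {real j..real j + 1}} f"
proof -
  obtain g where g: "oscillating lam r n g"
    "\<And>x. x \<in> {x_pt n..y_pt n} \<Longrightarrow> f x = d ^ n * (x_pt n + (y_pt n - x_pt n) * g (bcoord n x))"
    using band[OF n] unfolding bcoord_def by blast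
  have y: "0 < y_pt n - x_pt n" using pt_bounds(2)[OF n] by simp
  have f_le: "f x \<le> f z" if "x \<in> {x_pt n..y_pt n}" "z \<in> {x_pt n..y_pt n}"
    "g (bcoord n x) \<le> g (bcoord n z)" for x z
    using that y d_pos by (simp add: g(2))
  show ?thesis
  proof (cases "even j")
    case True
    then obtain k where k: "j = 2 * k" by blast
    then have "k < b n" using j by simp
    then have "mono_on {2 * real k..2 * real k + 1} g"
      using oscillating_facts(5)[OF n g(1)] by blast
    then have "mono_on {x \<in> {x_pt n..y_pt n}. bcoord n x \<in> {real j..real j + 1}} f"
      unfolding k using f_le bcoord_mono[OF n] by (auto simp: monotone_on_def)
    then show ?thesis ..
  next
    case False
    then obtain k where k: "j = 2 * k + 1" using oddE by blast
    then have "Suc k < b n" using j by simp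
    then have "antimono_on {2 * real k + 1..2 * real k + 2} g"
      using oscillating_facts(6)[OF n g(1)] by blast
    then have "antimono_on {x \<in> {x_pt n..y_pt n}. bcoord n x \<in> {real j..real j + 1}} f"
      unfolding k using f_le bcoord_mono[OF n] by (auto simp: monotone_on_def)
    then show ?thesis ..
  qed
qed

lemma band_covered:
  assumes "1 \<le> n"
  shows "{x_pt n..y_pt n} \<subseteq>
    (\<Union>j<2 * b n - 1. {x \<in> {x_pt n..y_pt n}. bcoord n x \<in> {real j..real j + 1}})"
proof
  fix x assume x: "x \<in> {x_pt n..y_pt n}"
  have u: "bcoord n x \<in> {0..2 * real (b n) - 1}" using bcoord_in[OF assms x] .
  have b1: "1 \<le> b n" using b_bounds(1)[OF assms] .
  define j where "j = min (nat \<lfloor>bcoord n x\<rfloor>) (2 * b n - 2)"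
  have "real j \<le> bcoord n x" using u by (auto simp: j_def min_def) linarith+
  moreover have "bcoord n x \<le> real j + 1"
    using u b1 by (auto simp: j_def min_def of_nat_diff)
  moreover have "j < 2 * b n - 1" using b1 by (simp add: j_def)
  ultimately show "x \<in> (\<Union>j<2 * b n - 1. {x \<in> {x_pt n..y_pt n}. bcoord n x \<in> {real j..real j + 1}})"
    using x by auto
qed

lemma outer_pieces_mono:
  "mono_on {0..5 / 2 * d} f" "mono_on {5 / 2 * d..1 / 2 - d} f" "mono_on {1 / 2 - d..1 / 2} f"
  "antimono_on {1 / 2..1 / 2 + d} f" "antimono_on {1 / 2 + d..1 - d} f" "antimono_on {1 - d..1} f"
  "mono_on {y_pt 1..4} f"
proof -
  have sub: "(f has_real_derivative deriv_on {0..4} f x) (at x within {a..c})"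
    if "0 \<le> a" "c \<le> 4" "x \<in> {a..c}" for a c x
    using that f_deriv[of x] has_field_derivative_subset[of f _ x "{0..4}" "{a..c}"] by force
  show "mono_on {0..5 / 2 * d} f"
    using f_left L_ge by (auto simp: monotone_on_def)
  show "mono_on {5 / 2 * d..1 / 2 - d} f"
    using sub f'_A d_pos by (intro mono_on_interval_if_deriv_nonneg[where g' = "deriv_on {0..4} f"]) force+
  show "antimono_on {1 / 2 + d..1 - d} f"
    using sub f'_B d_pos by (intro antimono_on_interval_if_deriv_nonpos[where g' = "deriv_on {0..4} f"]) force+
  show "mono_on {y_pt 1..4} f"
    using sub f'_C pt_bounds(1,2)[of 1] by (intro mono_on_interval_if_deriv_nonneg[where g' = "deriv_on {0..4} f"]) force+
  have sq: "f x \<le> f z" if "\<bar>x - 1 / 2\<bar> \<le> d" "\<bar>z - 1 / 2\<bar> \<le> \<bar>x - 1 / 2\<bar>" for x z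
  proof -
    have "(z - 1 / 2)\<^sup>2 \<le> (x - 1 / 2)\<^sup>2" using that(2) by (rule abs_le_square_iff[THEN iffD1])
    then show ?thesis using that f_half L_ge by (simp add: mult_left_mono)
  qed
  show "mono_on {1 / 2 - d..1 / 2} f" "antimono_on {1 / 2..1 / 2 + d} f"
    using sq by (auto simp: monotone_on_def)
  show "antimono_on {1 - d..1} f"
  proof (rule monotone_onI)
    fix x z assume xz: "x \<in> {1 - d..1}" "z \<in> {1 - d..1}" "x \<le> z"
    have "(z - 1) ^ (2 * r) \<le> (x - 1) ^ (2 * r)"
      using power_mono[of "1 - z" "1 - x" "2 * r"] xz
      by (metis atLeastAtMost_iff diff_ge_0_iff_ge diff_left_mono even_mult_iff even_numeral minus_diff_eq power_minus_even)
    then show "f z \<le> f x"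
      using f_one xz d_pos by (simp add: mult_left_mono)
  qed
qed

text \<open>
  Class \<open>n\<close> is mapped so close to \<open>0\<close> that the following \<open>n\<close> steps take place in the linear part of
  \<open>f\<close>: multiplication by \<open>L\<^sup>n\<close> brings the image to \<open>5 / 2\<close> at most.
\<close>

lemma f_class_range:
  assumes "1 \<le> n" "x \<in> {y_pt (Suc n)..y_pt n}"
  shows "0 \<le> f x" "f x \<le> 5 / 2 * d ^ n"
proof -
  note pts = pt_bounds[OF assms(1)] pt_bounds[of "Suc n"] w_bounds[OF assms(1)]
  show "0 \<le> f x" using f_into[of x] assms pts by auto
  have x_le: "d ^ n * x_pt n \<le> d ^ n * (5 / 2)"
    using pts d_pos by (intro mult_left_mono) auto
  have "d ^ Suc n \<le> d ^ n * 1" using d_pos d_le by (simp add: mult_left_le_one_le)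
  then have Suc_le: "d ^ Suc n * x_pt n \<le> d ^ n * x_pt n" using pts by (intro mult_right_mono) auto
  consider "x \<in> {y_pt (Suc n)..w n}" | "x \<in> {w n..x_pt n}" | "x \<in> {x_pt n..y_pt n}"
    using assms(2) by fastforce
  then show "f x \<le> 5 / 2 * d ^ n"
  proof cases
    case 1
    then have "f x \<le> f (w n)"
      using gap_mono(1)[OF assms(1)] pts by (auto simp: monotone_on_def)
    then show ?thesis using f_w[OF assms(1)] Suc_le x_le by simp
  next
    case 2
    then have "f x \<le> f (x_pt n)"
      using gap_mono(2)[OF assms(1)] pts by (auto simp: monotone_on_def)
    then show ?thesis using f_x_pt[OF assms(1)] x_le by simp
  next
    case 3
    obtain g where g: "oscillating lam r n g"
      "f x = d ^ n * (x_pt n + (y_pt n - x_pt n) * g (bcoord n x))"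
      using band[OF assms(1)] 3 unfolding bcoord_def by blast
    have "g (bcoord n x) \<le> 1"
      using oscillating_facts(2)[OF assms(1) g(1) bcoord_in[OF assms(1) 3]] by simp
    then have "x_pt n + (y_pt n - x_pt n) * g (bcoord n x) \<le> x_pt n + (y_pt n - x_pt n) * 1"
      using pts by (intro add_left_mono mult_left_mono) auto
    also have "\<dots> \<le> 5 / 2" using pts by simp
    finally show ?thesis unfolding g(2) using d_pos by (simp add: mult.commute)
  qed
qed

section \<open>The number of monotone pieces of the iterates\<close>

lemma iter_near_zero: "0 \<le> x \<Longrightarrow> L ^ l * x \<le> 5 / 2 \<Longrightarrow> (f ^^ l) x = L ^ l * x"
proof (induction l)
  case (Suc l)
  have "L ^ l * x \<le> L ^ Suc l * x"
    using L_ge Suc.prems(1) by (intro mult_right_mono power_increasing) auto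
  then have "(f ^^ l) x = L ^ l * x" using Suc by linarith
  moreover have "L ^ l * x \<le> 5 / 2 * d"
  proof -
    have "L ^ l * x = d * (L ^ Suc l * x)"
      using dL by (metis mult.assoc mult_1 power_Suc)
    also have "\<dots> \<le> d * (5 / 2)"
      using Suc.prems(2) d_pos by (intro mult_left_mono) auto
    finally show ?thesis by simp
  qed
  ultimately show ?case using f_left[of "L ^ l * x"] L_ge Suc.prems(1) by simp
qed simp

lemma iter_after_class:
  assumes "0 \<le> f x" "f x \<le> 5 / 2 * d ^ n" "l \<le> n"
  shows "(f ^^ Suc l) x = L ^ l * f x" "(f ^^ Suc l) x \<le> 5 / 2 * d ^ (n - l)"
proof -
  have "L ^ l * f x \<le> L ^ l * (5 / 2 * d ^ n)"
    using assms(2) L_ge by (intro mult_left_mono) auto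
  also have "d ^ n = d ^ l * d ^ (n - l)"
    using \<open>l \<le> n\<close> by (simp flip: power_add)
  also have "L ^ l * (5 / 2 * (d ^ l * d ^ (n - l))) = 5 / 2 * (L ^ l * d ^ l) * d ^ (n - l)"
    by simp
  finally have le: "L ^ l * f x \<le> 5 / 2 * d ^ (n - l)" by (simp add: dL_power)
  also have "\<dots> \<le> 5 / 2 * 1"
    using d_pos d_le by (intro mult_left_mono power_le_one) auto
  finally show "(f ^^ Suc l) x = L ^ l * f x"
    using iter_near_zero[OF assms(1), of l] by (simp add: funpow_swap1)
  then show "(f ^^ Suc l) x \<le> 5 / 2 * d ^ (n - l)" using le by simp
qed

lemma orbit_in: "x \<in> {0..4} \<Longrightarrow> (f ^^ k) x \<in> {0..4}"
  by (induction k) (auto simp del: atLeastAtMost_iff intro: f_into)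

lemma class_iterates_monotone:
  assumes "1 \<le> n" "P \<subseteq> {y_pt (Suc n)..y_pt n}" "mono_on P f \<or> antimono_on P f" "k \<le> Suc n"
  shows "mono_on P (f ^^ k) \<or> antimono_on P (f ^^ k)"
proof (cases k)
  case 0
  then show ?thesis by (auto simp: monotone_on_def)
next
  case (Suc l)
  then have "(f ^^ k) x = L ^ l * f x" if "x \<in> P" for x
    using that assms f_class_range[of n x] iter_after_class(1)[of x n l] by auto
  moreover have "0 < L ^ l" using L_ge by simp
  ultimately show ?thesis
    using assms(3) by (auto simp: monotone_on_def)
qed

text \<open>
  The cost of a piece of class \<open>n\<close> has the same form whether or not the piece returns before time \<open>N\<close>.
  If it returns, the cover for the remaining \<open>N - n - 1\<close> steps is pulled back. Otherwise the piece itself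
  is a tame set, and \<open>n < N + c\<close> makes the right-hand side at least \<open>1\<close>.
\<close>

lemma class_piece_cover:
  assumes "1 \<le> n" "n < N + c"
    and P: "P \<subseteq> {y_pt (Suc n)..y_pt n}" "mono_on P f \<or> antimono_on P f"
    and IH: "\<And>N'. N' < N \<Longrightarrow> tame_cover f \<eta> N' {0..4} (lam ^ c * lam ^ N')"
  shows "tame_cover f \<eta> N P (lam ^ c * lam ^ (N - 1) / lam ^ n)"
proof (cases "Suc n \<le> N")
  case True
  show ?thesis
  proof (rule tame_cover_pullback[where \<tau> = "Suc n" and X = "{0..4}"])
    show "mono_on P (f ^^ k) \<or> antimono_on P (f ^^ k)" if "k \<le> Suc n" for k
      using class_iterates_monotone[OF \<open>1 \<le> n\<close> P that] .
    have "P \<subseteq> {0..4}"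
      using P(1) pt_bounds(1,2)[of "Suc n"] pt_bounds(3)[of n] \<open>1 \<le> n\<close> by fastforce
    then show "(f ^^ Suc n) ` P \<subseteq> {0..4}" using orbit_in by blast
    have "N - 1 = n + (N - Suc n)" using True by simp
    then have "lam ^ c * lam ^ (N - 1) / lam ^ n = lam ^ c * lam ^ (N - Suc n)"
      using lam by (simp add: power_add)
    then show "tame_cover f \<eta> (N - Suc n) {0..4} (lam ^ c * lam ^ (N - 1) / lam ^ n)"
      using IH[of "N - Suc n"] True by simp
  qed fact
next
  case False
  show ?thesis
  proof (rule tame_coverI)
    show "tame f \<eta> N P"
      unfolding tame_def
    proof (intro allI impI)
      fix k assume "k < N"
      then have "k \<le> Suc n" using False by simp
      from class_iterates_monotone[OF \<open>1 \<le> n\<close> P this]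
      show "mono_on P (f ^^ k) \<or> antimono_on P (f ^^ k) \<or>
        (\<forall>x\<in>P. \<forall>y\<in>P. \<bar>(f ^^ k) x - (f ^^ k) y\<bar> \<le> \<eta>)" by blast
    qed
    have "lam ^ n \<le> lam ^ (c + (N - 1))"
      using lam assms(2) False by (intro power_increasing) auto
    then show "1 \<le> lam ^ c * lam ^ (N - 1) / lam ^ n"
      using lam by (simp add: power_add)
  qed
qed

text \<open>
  Class \<open>n\<close> consists of the \<open>2 * b n - 1\<close> branches of \<open>s\<^sub>n\<close> and the two parts of the gap, which is at
  most \<open>2 lam\<^sup>n / n\<^sup>2\<close> pieces. The factor \<open>1 / n\<^sup>2\<close> is what makes the sum over all classes
  converge.
\<close>

lemma class_cover:
  assumes "1 \<le> n" "n < N + c"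
    and IH: "\<And>N'. N' < N \<Longrightarrow> tame_cover f \<eta> N' {0..4} (lam ^ c * lam ^ N')"
  shows "tame_cover f \<eta> N {y_pt (Suc n)..y_pt n} (2 * (lam ^ c * lam ^ (N - 1)) * (1 / (real n)\<^sup>2))"
proof -
  define Q where "Q = lam ^ c * lam ^ (N - 1)"
  have "0 < Q" using lam by (simp add: Q_def)
  note pts = pt_bounds[OF assms(1)] w_bounds[OF assms(1)]
  note cover = class_piece_cover[OF assms(1,2) _ _ IH, folded Q_def]
  define B where "B j = {x \<in> {x_pt n..y_pt n}. bcoord n x \<in> {real j..real j + 1}}" for j
  have band: "tame_cover f \<eta> N (\<Union>j\<in>{..<2 * b n - 1}. B j) (\<Sum>j\<in>{..<2 * b n - 1}. Q / lam ^ n)"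
  proof (intro tame_cover_UN cover)
    show "B j \<subseteq> {y_pt (Suc n)..y_pt n}" for j using pts by (auto simp: B_def)
    show "mono_on (B j) f \<or> antimono_on (B j) f" if "j \<in> {..<2 * b n - 1}" for j
      using band_piece_mono[OF assms(1), of j] that unfolding B_def by simp
  qed auto
  have gap: "tame_cover f \<eta> N {y_pt (Suc n)..w n} (Q / lam ^ n)" "tame_cover f \<eta> N {w n..x_pt n} (Q / lam ^ n)"
    using pts gap_mono[OF assms(1)] by (auto intro!: cover)
  have "tame_cover f \<eta> N ((\<Union>j\<in>{..<2 * b n - 1}. B j) \<union> ({y_pt (Suc n)..w n} \<union> {w n..x_pt n}))
      ((\<Sum>j\<in>{..<2 * b n - 1}. Q / lam ^ n) + (Q / lam ^ n + Q / lam ^ n))"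
    by (intro tame_cover_Un band gap)
  moreover have "{y_pt (Suc n)..y_pt n} \<subseteq>
      (\<Union>j\<in>{..<2 * b n - 1}. B j) \<union> ({y_pt (Suc n)..w n} \<union> {w n..x_pt n})"
  proof -
    have "{y_pt (Suc n)..y_pt n} \<subseteq> {x_pt n..y_pt n} \<union> ({y_pt (Suc n)..w n} \<union> {w n..x_pt n})"
      by auto
    then show ?thesis using band_covered[OF assms(1), folded B_def] by blast
  qed
  moreover have "(\<Sum>j\<in>{..<2 * b n - 1}. Q / lam ^ n) + (Q / lam ^ n + Q / lam ^ n) \<le> 2 * Q * (1 / (real n)\<^sup>2)"
  proof -
    have "1 \<le> lam ^ n / (real n)\<^sup>2"
    proof -
      have "(real n)\<^sup>2 \<le> 2 * (real n + 1)\<^sup>2" by (simp add: power2_eq_square algebra_simps)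
      then show ?thesis using two_times_square_le_power[OF lam assms(1)] assms(1) by simp
    qed
    then have "real (2 * b n - 1) + 2 \<le> 2 * (lam ^ n / (real n)\<^sup>2)"
      using b_bounds(1,3)[OF assms(1)] by (simp add: of_nat_diff)
    then have "(real (2 * b n - 1) + 2) * (Q / lam ^ n) \<le> 2 * (lam ^ n / (real n)\<^sup>2) * (Q / lam ^ n)"
      using \<open>0 < Q\<close> lam by (intro mult_right_mono) auto
    also have "\<dots> = 2 * Q * (1 / (real n)\<^sup>2)" using lam by simp
    finally have "(real (2 * b n - 1) + 2) * (Q / lam ^ n) \<le> 2 * Q * (1 / (real n)\<^sup>2)" .
    moreover have "(\<Sum>j\<in>{..<2 * b n - 1}. Q / lam ^ n) = real (2 * b n - 1) * (Q / lam ^ n)"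
      by (simp only: sum_constant card_lessThan)
    ultimately show ?thesis unfolding distrib_right by linarith
  qed
  ultimately show ?thesis unfolding Q_def[symmetric] using tame_cover_mono by blast
qed

lemma y_pt_intervals_cover:
  assumes "m \<le> k"
  shows "{y_pt k..y_pt m} \<subseteq> {y_pt k} \<union> (\<Union>n\<in>{m..<k}. {y_pt (Suc n)..y_pt n})"
  using assms
proof (induction k rule: dec_induct)
  case base
  show ?case by auto
next
  case (step k)
  show ?case
  proof
    fix x assume x: "x \<in> {y_pt (Suc k)..y_pt m}"
    show "x \<in> {y_pt (Suc k)} \<union> (\<Union>n\<in>{m..<Suc k}. {y_pt (Suc n)..y_pt n})"
    proof (cases "x \<le> y_pt k")
      case True
      then have "x \<in> {y_pt (Suc k)..y_pt k}" "k \<in> {m..<Suc k}" using x step.hyps by auto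
      then show ?thesis by blast
    next
      case False
      then have "x \<in> {y_pt k..y_pt m}" "x \<noteq> y_pt k" using x by auto
      then obtain n where "n \<in> {m..<k}" "x \<in> {y_pt (Suc n)..y_pt n}"
        using step.IH by blast
      then have "n \<in> {m..<Suc k}" "x \<in> {y_pt (Suc n)..y_pt n}" by auto
      then show ?thesis by blast
    qed
  qed
qed

lemma in_class:
  assumes "1 < x" "x \<le> y_pt m"
  obtains n where "m \<le> n" "x \<in> {y_pt (Suc n)..y_pt n}"
proof -
  obtain k0 where k0: "2 / (x - 1) < real k0" using reals_Archimedean2 by blast
  define k where "k = max (Suc m) k0"
  have k: "m < k" "2 / (x - 1) < real k" using k0 by (auto simp: k_def)
  have "y_pt k < x"
  proof -
    have "1 \<le> real k" using k(1) by simp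
    then have "1 / (2 * (real k)\<^sup>2) \<le> 1 / real k"
      by (simp add: divide_simps power2_eq_square)
    then have "y_pt k \<le> 1 + 2 / real k" by (simp add: y_pt_def x_pt_def)
    also have "2 / real k < x - 1"
      using k(2) \<open>1 < x\<close> \<open>1 \<le> real k\<close> by (simp add: field_simps)
    finally show ?thesis by simp
  qed
  then have "x \<in> {y_pt k..y_pt m}" using assms(2) by simp
  then have "x \<in> {y_pt k} \<union> (\<Union>n\<in>{m..<k}. {y_pt (Suc n)..y_pt n})"
    using y_pt_intervals_cover[of m k] k(1) by (meson less_imp_le subsetD)
  then obtain n where "n \<in> {m..<k}" "x \<in> {y_pt (Suc n)..y_pt n}"
    using \<open>y_pt k < x\<close> by blast
  then show ?thesis using that[of n] by simp
qed

lemma f_tail_range: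
  assumes "1 \<le> m" "x \<in> {1..y_pt m}"
  shows "0 \<le> f x" "f x \<le> 5 / 2 * d ^ m"
proof -
  have "x \<in> {0..4}" using assms pt_bounds(3)[OF assms(1)] by auto
  then show "0 \<le> f x" using f_into by fastforce
  show "f x \<le> 5 / 2 * d ^ m"
  proof (cases "x = 1")
    case True
    have "f 1 = 0" using f_one[of 1] d_pos r by simp
    then show ?thesis using True d_pos by simp
  next
    case False
    then obtain n where n: "m \<le> n" "x \<in> {y_pt (Suc n)..y_pt n}"
      using in_class[of x m] assms by auto
    then have "f x \<le> 5 / 2 * d ^ n"
      using f_class_range(2)[of n x] assms(1) by simp
    also have "\<dots> \<le> 5 / 2 * d ^ m"
      using n(1) d_pos d_le by (intro mult_left_mono power_decreasing) auto
    finally show ?thesis .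
  qed
qed

text \<open>
  Infinitely many folds accumulate at \<open>1\<close>, but those of the classes \<open>n \<ge> N + c\<close> remain within \<open>\<eta>\<close> of
  \<open>0\<close> from time \<open>1\<close> to time \<open>N - 1\<close>: the images start below \<open>5 / 2 * d ^ (N + c)\<close> and grow by \<open>1 / d\<close> in each step.
\<close>

lemma tail_tame:
  assumes "5 / 2 * d ^ c \<le> \<eta>" "1 \<le> N + c"
  shows "tame f \<eta> N {1..y_pt (N + c)}"
  unfolding tame_def
proof (intro allI impI)
  fix k assume "k < N"
  let ?A = "{1..y_pt (N + c)}"
  show "mono_on ?A (f ^^ k) \<or> antimono_on ?A (f ^^ k) \<or> (\<forall>x\<in>?A. \<forall>y\<in>?A. \<bar>(f ^^ k) x - (f ^^ k) y\<bar> \<le> \<eta>)"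
  proof (cases k)
    case 0
    then show ?thesis by (auto simp: monotone_on_def)
  next
    case (Suc l)
    have "0 \<le> (f ^^ k) x \<and> (f ^^ k) x \<le> \<eta>" if "x \<in> ?A" for x
    proof -
      note fx = f_tail_range[OF assms(2) that]
      have "l \<le> N + c" using Suc \<open>k < N\<close> by simp
      note it = iter_after_class[OF fx this]
      have "d ^ (N + c - l) \<le> d ^ c"
        using d_pos d_le Suc \<open>k < N\<close> by (intro power_decreasing) auto
      then have "(f ^^ k) x \<le> \<eta>" using it(2) assms(1) Suc by simp
      moreover have "0 \<le> (f ^^ k) x" using it(1) fx(1) L_ge Suc by simp
      ultimately show ?thesis by simp
    qed
    note bounds = this
    have "\<bar>(f ^^ k) x - (f ^^ k) y\<bar> \<le> \<eta>" if "x \<in> ?A" "y \<in> ?A" for x y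
      using bounds[OF that(1)] bounds[OF that(2)] by linarith
    then show ?thesis by blast
  qed
qed

text \<open>
  Induction on \<open>N\<close> with \<open>Q = lam\<^sup>c * lam\<^sup>N\<^sup>-\<^sup>1\<close> as unit: the seven pieces outside \<open>(1, y\<^sub>1)\<close> cost \<open>7 * Q\<close>, the
  tail \<open>Q\<close>, and all classes together \<open>2 * Q * (\<Sum>n. 1 / n\<^sup>2) \<le> 4 * Q\<close>. The total \<open>12 * Q\<close> is at most
  \<open>lam * Q\<close>.
\<close>

lemma tame_cover_all:
  assumes "5 / 2 * d ^ c \<le> \<eta>"
  shows "tame_cover f \<eta> N {0..4} (lam ^ c * lam ^ N)"
proof (induction N rule: less_induct)
  case (less N)
  show ?case
  proof (cases "N = 0")
    case True
    then show ?thesis using lam by (intro tame_coverI) (auto simp: tame_def)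
  next
    case False
    define Q where "Q = lam ^ c * lam ^ (N - 1)"
    have "1 \<le> Q" using lam mult_mono[of 1 "lam ^ c" 1 "lam ^ (N - 1)"] by (simp add: Q_def)
    define m where "m = N + c"
    have "1 \<le> m" using False by (simp add: m_def)
    have outer: "tame_cover f \<eta> N P Q" if "P \<subseteq> {0..4}" "mono_on P f \<or> antimono_on P f" for P
    proof (rule tame_cover_pullback[where \<tau> = 1 and X = "{0..4}"])
      show "mono_on P (f ^^ k) \<or> antimono_on P (f ^^ k)" if "k \<le> 1" for k
        using \<open>mono_on P f \<or> antimono_on P f\<close> that by (cases k) (auto simp: monotone_on_def)
      show "(f ^^ 1) ` P \<subseteq> {0..4}" using that f_into by auto
      show "tame_cover f \<eta> (N - 1) {0..4} Q" using less[of "N - 1"] False by (simp add: Q_def)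
    qed (use False in auto)
    have tail: "tame_cover f \<eta> N {1..y_pt m} Q"
      using tail_tame[OF assms, of N] \<open>1 \<le> m\<close> \<open>1 \<le> Q\<close> unfolding m_def by (intro tame_coverI)
    have classes: "tame_cover f \<eta> N (\<Union>n\<in>{1..<m}. {y_pt (Suc n)..y_pt n})
        (\<Sum>n\<in>{1..<m}. 2 * Q * (1 / (real n)\<^sup>2))"
      unfolding Q_def by (intro tame_cover_UN class_cover less) (auto simp: m_def)
    define O1 where "O1 = {0..5 / 2 * d} \<union> ({5 / 2 * d..1 / 2 - d} \<union> ({1 / 2 - d..1 / 2} \<union>
      ({1 / 2..1 / 2 + d} \<union> ({1 / 2 + d..1 - d} \<union> ({1 - d..1} \<union> {y_pt 1..4})))))"
    have "tame_cover f \<eta> N O1 (Q + (Q + (Q + (Q + (Q + (Q + Q))))))"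
      unfolding O1_def
      using d_pos d_le outer_pieces_mono pt_bounds(1,2)[of 1]
      by (intro tame_cover_Un outer) auto
    then have all: "tame_cover f \<eta> N (O1 \<union> ({1..y_pt m} \<union> (\<Union>n\<in>{1..<m}. {y_pt (Suc n)..y_pt n})))
        ((Q + (Q + (Q + (Q + (Q + (Q + Q)))))) + (Q + (\<Sum>n\<in>{1..<m}. 2 * Q * (1 / (real n)\<^sup>2))))"
      by (intro tame_cover_Un tail classes)
    have "{0..4} \<subseteq> O1 \<union> ({1..y_pt m} \<union> (\<Union>n\<in>{1..<m}. {y_pt (Suc n)..y_pt n}))"
    proof
      fix x :: real assume x: "x \<in> {0..4}"
      have "x \<in> O1 \<or> x \<in> {1..y_pt m} \<or> x \<in> {y_pt m..y_pt 1}"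
        using x unfolding O1_def by auto
      moreover have "y_pt m \<in> {1..y_pt m}" using pt_bounds(1,2)[OF \<open>1 \<le> m\<close>] by simp
      ultimately show "x \<in> O1 \<union> ({1..y_pt m} \<union> (\<Union>n\<in>{1..<m}. {y_pt (Suc n)..y_pt n}))"
        using y_pt_intervals_cover[OF \<open>1 \<le> m\<close>] by blast
    qed
    moreover have "(Q + (Q + (Q + (Q + (Q + (Q + Q)))))) + (Q + (\<Sum>n\<in>{1..<m}. 2 * Q * (1 / (real n)\<^sup>2)))
        \<le> lam ^ c * lam ^ N"
    proof -
      have "(\<Sum>n\<in>{1..<m}. 2 * Q * (1 / (real n)\<^sup>2)) = 2 * Q * (\<Sum>n\<in>{1..<m}. 1 / (real n)\<^sup>2)"
        by (rule sum_distrib_left[symmetric])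
      also have "\<dots> \<le> 2 * Q * 2"
        using \<open>1 \<le> Q\<close> sum_inverse_squares_le[of m] by (intro mult_left_mono) auto
      finally have "(Q + (Q + (Q + (Q + (Q + (Q + Q)))))) + (Q + (\<Sum>n\<in>{1..<m}. 2 * Q * (1 / (real n)\<^sup>2)))
          \<le> 12 * Q" by simp
      also have "\<dots> \<le> lam * Q" using lam \<open>1 \<le> Q\<close> by (intro mult_right_mono) auto
      also have "\<dots> = lam ^ c * lam ^ N"
        using False by (cases N) (auto simp: Q_def)
      finally show ?thesis .
    qed
    ultimately show ?thesis using tame_cover_mono[OF all] by blast
  qed
qed

lemma card_separated_le_power:
  assumes "0 < \<eta>"
  obtains A where "1 \<le> A" "\<And>N E. finite E \<Longrightarrow> E \<subseteq> {0..4} \<Longrightarrow> separated_set f \<eta> N E \<Longrightarrow>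
      real (card E) \<le> A * lam ^ N * (4 / \<eta> * real N + 1)"
proof -
  obtain c where c: "d ^ c < 2 / 5 * \<eta>"
    using real_arch_pow_inv[of "2 / 5 * \<eta>" d] d_le assms by auto
  show ?thesis
  proof
    show "1 \<le> lam ^ c" using lam by simp
    fix N E assume E: "finite E" "E \<subseteq> {0..4}" "separated_set f \<eta> N E"
    have into: "f ` {0..4} \<subseteq> {0..4}" using f_into by blast
    show "real (card E) \<le> lam ^ c * lam ^ N * (4 / \<eta> * real N + 1)"
      using card_separated_le_tame_cover[OF tame_cover_all[of c \<eta> N] into assms _ E] c by simp
  qed
qed

section \<open>The growth rate\<close>

text \<open>
  The derivative within a nondegenerate subinterval determines the one within \<open>[0, 4]\<close>. Applied to the
  explicit pieces of \<open>f\<close> this also covers their end points, where two pieces meet.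
\<close>

lemma deriv_eqI:
  assumes "{a..c} \<subseteq> {0..4}" "a < c" "x \<in> {a..c}"
    and "(h has_real_derivative D) (at x within {a..c})" "\<And>z. z \<in> {a..c} \<Longrightarrow> f z = h z"
  shows "deriv_on {0..4} f x = D"
proof -
  have "x \<in> {0..4}" using assms(1,3) by blast
  then show ?thesis
    using deriv_eq_on_subinterval[OF f_deriv assms(1-4)] assms(5) by blast
qed

text \<open>
  The chain rule multiplies the slope of \<open>s\<^sub>n\<close>, at most \<open>L\<close>, by \<open>lam\<^sup>-\<^sup>n\<^sup>r * M\<^sub>n\<close>, and
  \<open>M\<^sub>n \<le> lam\<^sup>n \<le> L\<^sup>n\<close>.
\<close>

lemma abs_deriv_band_le:
  assumes n: "1 \<le> n" and x: "x \<in> {x_pt n..y_pt n}"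
  shows "\<bar>deriv_on {0..4} f x\<bar> \<le> L"
proof -
  define M where "M = 2 * real (b n) - 1"
  define l where "l = y_pt n - x_pt n"
  obtain g where g: "oscillating lam r n g"
    "\<And>x. x \<in> {x_pt n..y_pt n} \<Longrightarrow> f x = d ^ n * (x_pt n + l * g (M / l * (x - x_pt n)))"
    using band[OF n] unfolding M_def l_def by blast
  have "0 < l" using pt_bounds(2)[OF n] by (simp add: l_def)
  have "0 < M" using b_bounds(1)[OF n] by (simp add: M_def)
  define D where "D = deriv_on {0..M} g (M / l * (x - x_pt n))"
  have dom: "M / l * (z - x_pt n) \<in> {0..M}" if "z \<in> {x_pt n..y_pt n}" for z
    using bcoord_in[OF n that] by (simp add: bcoord_def M_def l_def)
  have "(g has_real_derivative D) (at (M / l * (x - x_pt n)) within {0..M})"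
    unfolding D_def using oscillating_facts(1)[OF n g(1)] dom[OF x]
    by (intro Ck_on_has_real_derivative[of 1]) (auto simp: smooth_on_def M_def)
  then have "((\<lambda>x. g (M / l * (x - x_pt n))) has_real_derivative D * (M / l))
      (at x within {x_pt n..y_pt n})"
    by (rule has_real_derivative_rescale) (rule dom)
  then have "((\<lambda>x. d ^ n * (x_pt n + l * g (M / l * (x - x_pt n)))) has_real_derivative
      d ^ n * (l * (D * (M / l)))) (at x within {x_pt n..y_pt n})"
    by (auto intro!: derivative_eq_intros)
  then have "deriv_on {0..4} f x = d ^ n * (l * (D * (M / l)))"
    using x pt_bounds(1-3)[OF n] g(2) by (intro deriv_eqI[of "x_pt n" "y_pt n"]) auto
  also have "\<dots> = d ^ n * M * D" using \<open>0 < l\<close> by simp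
  finally have "\<bar>deriv_on {0..4} f x\<bar> = d ^ n * M * \<bar>D\<bar>"
    using d_pos \<open>0 < M\<close> by (simp add: abs_mult)
  also have "\<dots> \<le> 1 * L"
  proof (rule mult_mono)
    have "M \<le> lam ^ n / (real n)\<^sup>2" using b_bounds(3)[OF n] by (simp add: M_def)
    also have "\<dots> \<le> lam ^ n / 1"
      using lam n by (intro divide_left_mono) auto
    also have "\<dots> \<le> L ^ n" using lam lam_le_L by (simp add: power_mono)
    finally have "d ^ n * M \<le> d ^ n * L ^ n" using d_pos by (intro mult_left_mono) auto
    then show "d ^ n * M \<le> 1" by (simp add: dL_power)
    show "\<bar>D\<bar> \<le> L"
      unfolding D_def M_def using oscillating_facts(3)[OF n g(1)] dom[OF x] unfolding M_def by blast
  qed auto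
  finally show ?thesis by simp
qed

lemma deriv_at_4: "deriv_on {0..4} f 4 = L"
  using d_pos d_le f_right
  by (intro deriv_eqI[of "4 - 3 / 2 * d" 4 4 "\<lambda>x. 4 + L * (x - 4)"])
    (auto intro!: derivative_eq_intros)

lemma abs_deriv_le:
  assumes "x \<in> {0..4}"
  shows "\<bar>deriv_on {0..4} f x\<bar> \<le> L"
proof -
  have "x \<in> {0..5 / 2 * d} \<or> x \<in> {5 / 2 * d..1 / 2 - d} \<or> x \<in> {1 / 2 - d..1 / 2 + d} \<or>
    x \<in> {1 / 2 + d..1 - d} \<or> x \<in> {1 - d..1} \<or> x \<in> {1<..y_pt 1} \<or> x \<in> {y_pt 1..4}"
    using assms by auto
  then consider "x \<in> {0..5 / 2 * d}" | "x \<in> {5 / 2 * d..1 / 2 - d}" | "x \<in> {1 / 2 - d..1 / 2 + d}" |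
    "x \<in> {1 / 2 + d..1 - d}" | "x \<in> {1 - d..1}" | "x \<in> {1<..y_pt 1}" | "x \<in> {y_pt 1..4}"
    by blast
  then show ?thesis
  proof cases
    case 1
    then have "deriv_on {0..4} f x = L"
      using d_pos d_le f_left by (intro deriv_eqI[of 0 "5 / 2 * d" x "\<lambda>x. L * x"])
        (auto intro!: derivative_eq_intros)
    then show ?thesis using L_ge by simp
  next
    case 2
    then show ?thesis using f'_A[of x] by auto
  next
    case 3
    have "deriv_on {0..4} f x = - (3 / 2 * L * (2 * (x - 1 / 2)))"
    proof (rule deriv_eqI[of "1 / 2 - d" "1 / 2 + d" x "\<lambda>x. 4 - 3 / 2 * L * (x - 1 / 2)\<^sup>2"])
      show "((\<lambda>x. 4 - 3 / 2 * L * (x - 1 / 2)\<^sup>2) has_real_derivative - (3 / 2 * L * (2 * (x - 1 / 2))))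
          (at x within {1 / 2 - d..1 / 2 + d})"
        by (auto intro!: derivative_eq_intros)
      show "f z = 4 - 3 / 2 * L * (z - 1 / 2)\<^sup>2" if "z \<in> {1 / 2 - d..1 / 2 + d}" for z
        using that f_half[of z] by (simp add: abs_le_iff)
    qed (use 3 d_pos d_le in auto)
    moreover have "\<bar>- (3 / 2 * L * (2 * (x - 1 / 2)))\<bar> = 3 * L * \<bar>x - 1 / 2\<bar>"
    proof -
      have "\<bar>- (3 / 2 * L * (2 * u))\<bar> = 3 * L * \<bar>u\<bar>" for u
        using L_ge by (simp add: abs_mult)
      then show ?thesis .
    qed
    moreover have "3 * L * \<bar>x - 1 / 2\<bar> \<le> 3 * L * d"
      using 3 L_ge by (intro mult_left_mono) (auto simp: abs_le_iff)
    moreover have "3 * L * d = 3" using dL by (simp add: mult.commute)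
    ultimately show ?thesis using L_ge by linarith
  next
    case 4
    then show ?thesis using f'_B[of x] L_ge by auto
  next
    case 5
    define D where "D = d powi (1 - 2 * int r) * (real (2 * r) * (x - 1) ^ (2 * r - 1))"
    have "deriv_on {0..4} f x = D"
    proof (rule deriv_eqI[of "1 - d" 1 x "\<lambda>x. d powi (1 - 2 * int r) * (x - 1) ^ (2 * r)"])
      show "((\<lambda>x. d powi (1 - 2 * int r) * (x - 1) ^ (2 * r)) has_real_derivative D)
          (at x within {1 - d..1})"
        unfolding D_def by (auto intro!: derivative_eq_intros)
    qed (use 5 d_pos d_le f_one in auto)
    also have "\<bar>D\<bar> = d powi (1 - 2 * int r) * (real (2 * r) * \<bar>x - 1\<bar> ^ (2 * r - 1))"
      using d_pos by (simp add: D_def abs_mult power_abs)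
    also have "\<dots> \<le> d powi (1 - 2 * int r) * (real (2 * r) * d ^ (2 * r - 1))"
      using 5 d_pos by (intro mult_left_mono power_mono) auto
    also have "\<dots> = real (2 * r)"
    proof -
      have "1 - 2 * int r = - int (2 * r - 1)" using r by (simp add: of_nat_diff)
      then have "d powi (1 - 2 * int r) = inverse (d ^ (2 * r - 1))"
        by (simp only: power_int_minus power_int_of_nat)
      then show ?thesis using d_pos by simp
    qed
    also have "\<dots> \<le> L"
    proof -
      have "2 * real r \<le> 2 * (real r + 1)\<^sup>2" by (simp add: power2_eq_square algebra_simps)
      also have "\<dots> \<le> L" unfolding L_def by (rule two_times_square_le_power[OF lam r])
      finally show ?thesis by simp
    qed
    finally show ?thesis .
  next
    case 6
    then obtain n where n: "1 \<le> n" "x \<in> {y_pt (Suc n)..y_pt n}"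
      using in_class[of x 1] by auto
    note pts = pt_bounds[OF n(1)] pt_bounds(1,2)[of "Suc n"] w_bounds[OF n(1)]
    consider "x \<in> {y_pt (Suc n)..w n}" | "x \<in> {w n..x_pt n}" | "x \<in> {x_pt n..y_pt n}"
      using n(2) by fastforce
    then show ?thesis
    proof cases
      case 1
      have "deriv_on {0..4} f x = 2 * d ^ n"
        using 1 pts gap_affine[OF n(1)]
        by (intro deriv_eqI[of "y_pt (Suc n)" "w n" x
            "\<lambda>x. d ^ Suc n * y_pt (Suc n) + 2 * d ^ n * (x - y_pt (Suc n))"])
          (auto intro!: derivative_eq_intros)
      moreover have "2 * d ^ n \<le> 2 * 1"
        using d_pos d_le by (intro mult_left_mono power_le_one) auto
      ultimately show ?thesis using L_ge d_pos by simp
    next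
      case 2
      obtain f' where f': "(f has_real_derivative f' x) (at x within {w n..x_pt n})" "0 \<le> f' x" "f' x \<le> L"
        using gap_transition_deriv[OF n(1)] 2 by metis
      then have "deriv_on {0..4} f x = f' x"
        using 2 pts by (intro deriv_eqI[of "w n" "x_pt n" x f]) auto
      then show ?thesis using f' by simp
    next
      case 3
      then show ?thesis by (rule abs_deriv_band_le[OF n(1)])
    qed
  next
    case 7
    then show ?thesis using f'_C[of x] by auto
  qed
qed

lemma f_4: "f 4 = 4"
  using f_right[of 4] d_pos by simp

lemma iter_deriv:
  assumes "x \<in> {0..4}"
  shows "\<exists>D. (f ^^ k has_real_derivative D) (at x within {0..4}) \<and> \<bar>D\<bar> \<le> L ^ k \<and> (x = 4 \<longrightarrow> D = L ^ k)"
proof (induction k)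
  case 0
  then show ?case by (intro exI[of _ 1]) (auto simp: id_def intro!: derivative_eq_intros)
next
  case (Suc k)
  then obtain D where D: "(f ^^ k has_real_derivative D) (at x within {0..4})" "\<bar>D\<bar> \<le> L ^ k"
    "x = 4 \<longrightarrow> D = L ^ k" by blast
  let ?z = "(f ^^ k) x"
  have z: "?z \<in> {0..4}" using orbit_in[OF assms] .
  have "(f has_real_derivative deriv_on {0..4} f ?z) (at ?z within (f ^^ k) ` {0..4})"
    using orbit_in by (intro has_field_derivative_subset[OF f_deriv[OF z]]) auto
  then have "(f ^^ Suc k has_real_derivative deriv_on {0..4} f ?z * D) (at x within {0..4})"
    using DERIV_image_chain[OF _ D(1)] by simp
  moreover have "\<bar>deriv_on {0..4} f ?z * D\<bar> \<le> L ^ Suc k"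
    using abs_deriv_le[OF z] D(2) L_ge by (simp add: abs_mult mult_mono)
  moreover have "deriv_on {0..4} f ?z * D = L ^ Suc k" if "x = 4"
  proof -
    have "(f ^^ k) 4 = 4" for k by (induction k) (auto simp: f_4)
    then show ?thesis using that D(3) deriv_at_4 by simp
  qed
  ultimately show ?case by blast
qed

text \<open>
  The chain rule gives the upper bound; it is attained at \<open>4\<close>, a fixed point of slope \<open>L\<close>.
\<close>

lemma sup_norm_iter: "sup_norm_on {0..4} (deriv_on {0..4} (f ^^ k)) = L ^ k"
  unfolding sup_norm_on_def
proof (rule cSup_eq_maximum)
  have eq: "\<exists>D. deriv_on {0..4} (f ^^ k) x = D \<and> \<bar>D\<bar> \<le> L ^ k \<and> (x = 4 \<longrightarrow> D = L ^ k)"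
    if "x \<in> {0..4}" for x
    using iter_deriv[OF that, of k] deriv_on_interval_eq[of "f ^^ k" _ x 0 4] that by force
  from eq[of 4] have "deriv_on {0..4} (f ^^ k) 4 = L ^ k" by simp
  then have "\<bar>deriv_on {0..4} (f ^^ k) 4\<bar> = L ^ k" using L_ge by simp
  then show "L ^ k \<in> (\<lambda>x. \<bar>deriv_on {0..4} (f ^^ k) x\<bar>) ` {0..4}"
    by (metis atLeastAtMost_iff image_eqI order.refl zero_le_numeral)
  show "y \<le> L ^ k" if "y \<in> (\<lambda>x. \<bar>deriv_on {0..4} (f ^^ k) x\<bar>) ` {0..4}" for y
    using that eq by fastforce
qed

lemma growth_rate_eq: "growth_rate {0..4} f = L"
proof -
  have "root k (sup_norm_on {0..4} (deriv_on {0..4} (f ^^ k))) = L" if "k \<in> {1..}" for k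
    using that L_ge by (simp add: sup_norm_iter real_root_power_cancel)
  then show ?thesis by (simp add: growth_rate_def)
qed

section \<open>Small horseshoes near 1\<close>

text \<open>
  The \<open>n\<close> linear steps near \<open>0\<close> undo the factor \<open>d\<^sup>n\<close>, so the return map to the band is \<open>s\<^sub>n\<close> up to
  an affine change of coordinates.
\<close>

lemma return_map:
  assumes "1 \<le> n" "oscillating lam r n g"
    "\<And>x. x \<in> {x_pt n..y_pt n} \<Longrightarrow> f x = d ^ n * (x_pt n + (y_pt n - x_pt n) * g (bcoord n x))"
    and "x \<in> {x_pt n..y_pt n}"
  shows "(f ^^ Suc n) x = x_pt n + (y_pt n - x_pt n) * g (bcoord n x)"
proof -
  have "x \<in> {y_pt (Suc n)..y_pt n}" using assms(4) pt_bounds(4)[OF assms(1)] by auto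
  then have "(f ^^ Suc n) x = L ^ n * f x"
    using f_class_range[OF assms(1)] by (intro iter_after_class) auto
  also have "\<dots> = (L ^ n * d ^ n) * (x_pt n + (y_pt n - x_pt n) * g (bcoord n x))"
    by (simp only: assms(3)[OF assms(4)] mult.assoc)
  finally show ?thesis by (simp only: dL_power mult_1)
qed

lemma horseshoe_branch:
  assumes "1 \<le> n" "k < b n" "u \<in> {x_pt n..y_pt n}"
  shows "\<exists>v\<in>{x_pt n..y_pt n}. (f ^^ Suc n) v = u \<and> bcoord n v \<in> {2 * real k..2 * real k + 1}"
proof -
  define l where "l = y_pt n - x_pt n"
  define M where "M = 2 * real (b n) - 1"
  have "0 < l" using pt_bounds(2)[OF assms(1)] by (simp add: l_def)
  have "0 < M" using b_bounds(1)[OF assms(1)] by (simp add: M_def)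
  obtain g where g: "oscillating lam r n g"
    "\<And>x. x \<in> {x_pt n..y_pt n} \<Longrightarrow> f x = d ^ n * (x_pt n + (y_pt n - x_pt n) * g (bcoord n x))"
    using band[OF assms(1)] unfolding bcoord_def by blast
  define t where "t = (u - x_pt n) / l"
  have t: "0 \<le> t" "t \<le> 1" "u = x_pt n + l * t"
    using assms(3) \<open>0 < l\<close> by (auto simp: t_def l_def)
  have sub: "{2 * real k..2 * real k + 1} \<subseteq> {0..M}" using assms(2) by (auto simp: M_def)
  have "Ck_on 1 {0..M} g"
    using oscillating_facts(1)[OF assms(1) g(1)] by (simp add: smooth_on_def M_def)
  then have "continuous_on {0..M} g"
    unfolding continuous_on_eq_continuous_within
    using Ck_on_has_real_derivative[of 1 "{0..M}" g] DERIV_continuous by blast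
  then have "continuous_on {2 * real k..2 * real k + 1} g"
    using sub continuous_on_subset by blast
  then obtain \<tau> where \<tau>: "2 * real k \<le> \<tau>" "\<tau> \<le> 2 * real k + 1" "g \<tau> = t"
    using IVT'[of g "2 * real k" t "2 * real k + 1"] t oscillating_facts(7,8)[OF assms(1) g(1) assms(2)]
    by auto
  define v where "v = x_pt n + l * (\<tau> / M)"
  have "\<tau> \<in> {0..M}" using \<tau> sub by auto
  then have "0 \<le> \<tau> / M" "\<tau> / M \<le> 1" using \<open>0 < M\<close> by auto
  then have "0 \<le> l * (\<tau> / M)" "l * (\<tau> / M) \<le> l"
    using \<open>0 < l\<close> mult_left_le[of "\<tau> / M" l] mult_nonneg_nonneg[of l "\<tau> / M"] by auto
  then have v: "v \<in> {x_pt n..y_pt n}" by (simp add: v_def l_def)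
  have bv: "bcoord n v = \<tau>"
    using \<open>0 < l\<close> \<open>0 < M\<close> by (simp add: bcoord_def v_def flip: l_def M_def)
  have "(f ^^ Suc n) v = u"
    using return_map[OF assms(1) g v] t(3) \<tau>(3) by (simp only: bv l_def)
  then show ?thesis using v bv \<tau> by auto
qed

lemma return_map_fixes_x_pt:
  assumes "1 \<le> n"
  shows "(f ^^ Suc n) (x_pt n) = x_pt n"
proof -
  obtain g where g: "oscillating lam r n g"
    "\<And>x. x \<in> {x_pt n..y_pt n} \<Longrightarrow> f x = d ^ n * (x_pt n + (y_pt n - x_pt n) * g (bcoord n x))"
    using band[OF assms] unfolding bcoord_def by blast
  have "(f ^^ Suc n) (x_pt n) = x_pt n + (y_pt n - x_pt n) * g (bcoord n (x_pt n))"
    using return_map[OF assms g] pt_bounds(2)[OF assms] by simp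
  then show ?thesis
    using oscillating_facts(4)[OF assms g(1)] by (simp only: bcoord_def) simp
qed

text \<open>
  At intermediate times the band is only a contracted copy of its final image, and \<open>\<bar>s\<^sub>n\<bar> \<le> 1\<close>.
\<close>

lemma band_orbit_close:
  assumes "1 \<le> n" "x \<in> {x_pt n..y_pt n}" "l \<le> n"
  shows "\<bar>(f ^^ l) x - (f ^^ l) (x_pt n)\<bar> \<le> y_pt n - x_pt n"
proof (cases l)
  case 0
  then show ?thesis using assms by auto
next
  case (Suc i)
  obtain g where g: "oscillating lam r n g"
    "\<And>x. x \<in> {x_pt n..y_pt n} \<Longrightarrow> f x = d ^ n * (x_pt n + (y_pt n - x_pt n) * g (bcoord n x))"
    using band[OF assms(1)] unfolding bcoord_def by blast
  have x0: "x_pt n \<in> {x_pt n..y_pt n}" using pt_bounds(2)[OF assms(1)] by simp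
  have sub: "{x_pt n..y_pt n} \<subseteq> {y_pt (Suc n)..y_pt n}" using pt_bounds(4)[OF assms(1)] by auto
  have it: "(f ^^ l) z = L ^ i * f z" if "z \<in> {x_pt n..y_pt n}" for z
    unfolding Suc
    using f_class_range[OF assms(1)] that sub Suc assms(3) by (intro iter_after_class[of z n]) auto
  have fx0: "f (x_pt n) = d ^ n * x_pt n" using f_x_pt[OF assms(1)] .
  define G where "G = (y_pt n - x_pt n) * g (bcoord n x)"
  have "(f ^^ l) x - (f ^^ l) (x_pt n) = L ^ i * d ^ n * G"
    unfolding it[OF x0] it[OF assms(2)] fx0 g(2)[OF assms(2)] G_def by (simp add: algebra_simps)
  moreover have "L ^ i * d ^ n \<le> 1"
  proof -
    have "L ^ i * d ^ n \<le> L ^ n * d ^ n"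
      using L_ge d_pos Suc assms(3) by (intro mult_right_mono power_increasing) auto
    then show ?thesis by (simp add: dL_power)
  qed
  moreover have "\<bar>G\<bar> \<le> y_pt n - x_pt n"
    unfolding G_def abs_mult
    using oscillating_facts(2)[OF assms(1) g(1) bcoord_in[OF assms(1,2)]] pt_bounds(2)[OF assms(1)]
    by (simp add: mult_left_le)
  ultimately show ?thesis
    using L_ge d_pos mult_mono[of "L ^ i * d ^ n" 1 "\<bar>G\<bar>" "y_pt n - x_pt n"]
    by (simp add: abs_mult)
qed

text \<open>
  Two different increasing branches are separated by a decreasing one, which has length \<open>1\<close> in
  the coordinate of \<open>s\<^sub>n\<close> and hence \<open>(y\<^sub>n - x\<^sub>n) / M\<^sub>n\<close> in the band; this bounds the scale \<open>\<eta>\<close>.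
\<close>

lemma local_growth_ge_branches:
  assumes n: "1 \<le> n" and \<epsilon>: "y_pt n - x_pt n < \<epsilon>"
    and \<eta>: "0 < \<eta>" "\<eta> < (y_pt n - x_pt n) / (2 * real (b n) - 1)"
  shows "ereal (ln (real (b n)) / real (Suc n)) \<le> local_growth {0..4} f \<epsilon> \<eta>"
proof -
  define J where "J = {x_pt n..y_pt n}"
  define F where "F = f ^^ Suc n"
  have J: "J \<subseteq> {0..4}" "x_pt n \<in> J"
    using pt_bounds(1-3)[OF n] by (auto simp: J_def)
  have "\<forall>k u. \<exists>v. k < b n \<longrightarrow> u \<in> J \<longrightarrow> v \<in> J \<and> F v = u \<and> bcoord n v \<in> {2 * real k..2 * real k + 1}"
    using horseshoe_branch[OF n] unfolding J_def F_def by blast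
  then obtain p where p: "\<And>k u. k < b n \<Longrightarrow> u \<in> J \<Longrightarrow>
      p k u \<in> J \<and> F (p k u) = u \<and> bcoord n (p k u) \<in> {2 * real k..2 * real k + 1}"
    by metis
  have gap: "dist (p k u) (p k' u') > \<eta>"
    if k: "k < b n" "k' < b n" "k \<noteq> k'" "u \<in> J" "u' \<in> J" for k k' u u'
  proof -
    define M where "M = 2 * real (b n) - 1"
    define l where "l = y_pt n - x_pt n"
    have "0 < l" "0 < M" using pt_bounds(2)[OF n] b_bounds(1)[OF n] by (auto simp: l_def M_def)
    have "1 \<le> \<bar>bcoord n (p k u) - bcoord n (p k' u')\<bar>"
      using p[OF k(1,4)] p[OF k(2,5)] k(3) by (cases k k' rule: linorder_cases) auto
    also have "\<dots> = \<bar>M / l * (p k u - p k' u')\<bar>"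
      unfolding bcoord_def M_def l_def by (simp add: right_diff_distrib)
    also have "\<dots> = M / l * \<bar>p k u - p k' u'\<bar>"
      using \<open>0 < l\<close> \<open>0 < M\<close> by (simp add: abs_mult)
    finally have "l / M \<le> \<bar>p k u - p k' u'\<bar>"
      using \<open>0 < l\<close> \<open>0 < M\<close> by (simp add: field_simps)
    then show ?thesis using \<eta>(2) by (simp add: dist_real_def l_def M_def)
  qed
  obtain A where A: "\<And>N E. finite E \<Longrightarrow> E \<subseteq> {0..4} \<Longrightarrow> separated_set f \<eta> N E \<Longrightarrow>
      real (card E) \<le> A * lam ^ N * (4 / \<eta> * real N + 1)"
    using card_separated_le_power[OF \<eta>(1)] by blast
  show ?thesis
  proof (rule local_growth_ge[OF _ _ _ A, of "x_pt n"])
    show "x_pt n \<in> {0..4}" using J by blast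
    show "1 \<le> b n" by (rule b_bounds(1)[OF n])
    show "\<exists>E. finite E \<and> E \<subseteq> bowen_ball {0..4} f (Suc n * j) (x_pt n) \<epsilon> \<and> card E = b n ^ j \<and>
      separated_set f \<eta> (Suc n * j) E" for j
    proof -
      obtain E where E: "finite E" "card E = b n ^ j" "\<forall>x\<in>E. \<forall>i\<le>j. (F ^^ i) x \<in> J"
        "separated_set F \<eta> j E"
        using horseshoe_separated_sets[of J \<eta> "b n" p F j] J(2) \<eta>(1) p gap by fastforce
      have iter: "(F ^^ i) x = (f ^^ (Suc n * i)) x" for i x
        by (simp only: F_def funpow_mult)
      have "separated_set f \<eta> (Suc n * j) E"
        unfolding separated_set_def
      proof (intro ballI impI)
        fix y z assume "y \<in> E" "z \<in> E" "y \<noteq> z"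
        then obtain i where "i < j" "dist ((F ^^ i) y) ((F ^^ i) z) > \<eta>"
          using E(4) unfolding separated_set_def by blast
        moreover from this have "Suc n * i < Suc n * j" by (metis Suc_mult_less_cancel1)
        ultimately show "\<exists>k<Suc n * j. dist ((f ^^ k) y) ((f ^^ k) z) > \<eta>"
          unfolding iter by blast
      qed
      moreover have "E \<subseteq> bowen_ball {0..4} f (Suc n * j) (x_pt n) \<epsilon>"
      proof
        fix x assume "x \<in> E"
        have "x \<in> {0..4}" using E(3) \<open>x \<in> E\<close> J(1) by (metis funpow_0 le0 subsetD)
        moreover have "dist ((f ^^ k) x) ((f ^^ k) (x_pt n)) < \<epsilon>" if "k < Suc n * j" for k
        proof -
          define i where "i = k div Suc n"
          define l where "l = k mod Suc n"
          have k: "k = l + Suc n * i" by (simp only: i_def l_def mod_mult_div_eq)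
          have fk: "(f ^^ k) z = (f ^^ l) ((F ^^ i) z)" for z
            by (simp only: k funpow_add o_apply iter)
          have "l \<le> n" by (simp add: l_def less_Suc_eq_le[symmetric])
          have "i \<le> j" using that unfolding i_def
            by (metis less_mult_imp_div_less less_imp_le mult.commute)
          then have "(F ^^ i) x \<in> J" using E(3) \<open>x \<in> E\<close> by blast
          moreover have "(F ^^ i) (x_pt n) = x_pt n"
          proof -
            have "F (x_pt n) = x_pt n"
              using return_map_fixes_x_pt[OF n] unfolding F_def .
            then show ?thesis by (induction i) simp_all
          qed
          ultimately show ?thesis
            using band_orbit_close[OF n _ \<open>l \<le> n\<close>, of "(F ^^ i) x"] \<epsilon>
            unfolding fk J_def dist_real_def by simp
        qed
        ultimately show "x \<in> bowen_ball {0..4} f (Suc n * j) (x_pt n) \<epsilon>"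
          by (simp add: bowen_ball_def)
      qed
      ultimately show ?thesis using E(1,2) by blast
    qed
  qed auto
qed

lemma local_entropy_eq: "local_entropy {0..4} f = ereal (ln lam)"
proof (rule local_entropy_eqI)
  fix \<epsilon> \<eta> :: real assume "0 < \<epsilon>" "0 < \<eta>"
  obtain A where "1 \<le> A" "\<And>N E. finite E \<Longrightarrow> E \<subseteq> {0..4} \<Longrightarrow> separated_set f \<eta> N E \<Longrightarrow>
      real (card E) \<le> A * lam ^ N * (4 / \<eta> * real N + 1)"
    using card_separated_le_power[OF \<open>0 < \<eta>\<close>] by blast
  then show "local_growth {0..4} f \<epsilon> \<eta> \<le> ereal (ln lam)"
    using lam \<open>0 < \<eta>\<close> by (intro local_growth_le[of A lam "4 / \<eta>"]) auto
next
  fix \<epsilon> c :: real assume "0 < \<epsilon>" "c < ln lam"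
  have "((\<lambda>n. (real n * ln lam - ln (4 * (real n)\<^sup>2)) / real (Suc n)) \<longlongrightarrow> ln lam) sequentially"
    by real_asymp
  then have "\<forall>\<^sub>F n in sequentially. c < (real n * ln lam - ln (4 * (real n)\<^sup>2)) / real (Suc n)"
    using \<open>c < ln lam\<close> by (rule order_tendstoD)
  moreover have "\<forall>\<^sub>F n in sequentially. 1 / (2 * (real n)\<^sup>2) < \<epsilon>"
  proof -
    have "((\<lambda>n. 1 / (2 * (real n)\<^sup>2)) \<longlongrightarrow> 0) sequentially" by real_asymp
    then show ?thesis using \<open>0 < \<epsilon>\<close> by (rule order_tendstoD)
  qed
  ultimately have "\<forall>\<^sub>F n in sequentially. 1 \<le> n \<and> 1 / (2 * (real n)\<^sup>2) < \<epsilon> \<and>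
      c < (real n * ln lam - ln (4 * (real n)\<^sup>2)) / real (Suc n)"
    using eventually_ge_at_top[of 1] by eventually_elim auto
  then have "\<exists>n. 1 \<le> n \<and> 1 / (2 * (real n)\<^sup>2) < \<epsilon> \<and>
      c < (real n * ln lam - ln (4 * (real n)\<^sup>2)) / real (Suc n)"
    by (rule eventually_happens'[OF sequentially_bot])
  then obtain n where n: "1 \<le> n" "1 / (2 * (real n)\<^sup>2) < \<epsilon>"
      "c < (real n * ln lam - ln (4 * (real n)\<^sup>2)) / real (Suc n)"
    by blast
  have "ln (lam ^ n / (4 * (real n)\<^sup>2)) \<le> ln (real (b n))"
    using b_bounds(2)[OF n(1)] lam n(1) by (intro ln_mono) auto
  moreover have "ln (lam ^ n / (4 * (real n)\<^sup>2)) = real n * ln lam - ln (4 * (real n)\<^sup>2)"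
    using lam n(1) by (simp add: ln_div ln_realpow)
  ultimately have "(real n * ln lam - ln (4 * (real n)\<^sup>2)) / real (Suc n) \<le> ln (real (b n)) / real (Suc n)"
    by (intro divide_right_mono) auto
  then have c: "c \<le> ln (real (b n)) / real (Suc n)" using n(3) by linarith
  define \<eta>0 where "\<eta>0 = (y_pt n - x_pt n) / (2 * real (b n) - 1)"
  show "\<exists>\<eta>0>0. \<forall>\<eta>. 0 < \<eta> \<and> \<eta> < \<eta>0 \<longrightarrow> ereal c \<le> local_growth {0..4} f \<epsilon> \<eta>"
  proof (intro exI[of _ \<eta>0] conjI allI impI)
    show "0 < \<eta>0" using pt_bounds(2)[OF n(1)] b_bounds(1)[OF n(1)] by (simp add: \<eta>0_def)
    fix \<eta> assume "0 < \<eta> \<and> \<eta> < \<eta>0"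
    moreover have "y_pt n - x_pt n < \<epsilon>" using n(2) by (simp add: y_pt_def)
    ultimately have "ereal (ln (real (b n)) / real (Suc n)) \<le> local_growth {0..4} f \<epsilon> \<eta>"
      using local_growth_ge_branches[OF n(1)] by (simp add: \<eta>0_def)
    then show "ereal c \<le> local_growth {0..4} f \<epsilon> \<eta>" using c by (meson ereal_less_eq(3) order_trans)
  qed
qed

end

theorem proposition3p6:
  fixes lam :: real and r :: nat and f :: "real \<Rightarrow> real"
  assumes "lam \<ge> 14" and "r \<ge> 1" and "is_f_map lam r f"
  shows "local_entropy {0..4} f = ereal (ln (growth_rate {0..4} f) / real r) \<and>
         ln (growth_rate {0..4} f) / real r = ln lam"
proof -
  interpret f_map lam r f using assms by unfold_locales
  have "ln (growth_rate {0..4} f) / real r = ln lam"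
    using lam r by (simp add: growth_rate_eq L_def ln_realpow)
  then show ?thesis using local_entropy_eq by simp
qed

end
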